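(* Let $\rho_{\mathrm T}(\Delta)$ denote the toric packing density of a Delzant polygon $\Delta\subset\mathbb{R}^2$. Let $a,b>0$ be real numbers. (i) If $\Delta$ is the Delzant triangle with parameter $a$, i.e. the triangle with vertices $(0,0),(a,0),(0,a)$, then $\rho_{\mathrm T}(\Delta)=1$. (ii) If $\Delta$ is the rectangle with parameters $a,b$, i.e. the rectangle with vertices $(0,0),(0,a),(b,a),(b,0)$, then $\rho_{\mathrm T}(\Delta)=\dfrac{\min\{a,b\}}{\max\{a,b\}}$. (iii) If $n\in\mathbb{Z}_{>0}$ and $\Delta$ is the Hirzebruch trapezoid with parameters $a,b,n$, i.e. the polygon with vertices $(0,0),(0,a),(b,a),(b+na,0)$, then $$\rho_{\mathrm T}(\Delta)=\begin{cases}\dfrac{2a}{na+2b} & \text{if } n>1,\\[2mm] \dfrac{2a}{a+2b} & \text{if } n=1 \text{ and } a\le b,\\[2mm] \dfrac{a^2+b^2+(a-b)^2}{(a+2b)a} & \text{if } n=1 \text{ and } b<a<2b,\\[2mm] \dfrac{a^2+2b^2}{(a+2b)a} & \text{if } n=1\text{ and } a\ge 2b.\end{cases}$$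
   Context: A Delzant polygon is a compact convex polygon $\Delta\subset\mathbb{R}^2$ each of whose edges is directed along an integer vector and such that, at each vertex, the primitive integer vectors $u_1,u_2\in\mathbb{Z}^2$ directing the two edges emanating from that vertex satisfy $\det(u_1,u_2)=\pm1$. For $\lambda>0$ the model triangle of size $\lambda$ is $B(\lambda)=\{(x,y)\in\mathbb{R}^2 : x\ge 0,\ y\ge 0,\ x+y<\lambda\}$. If $p$ is a vertex of the Delzant polygon $\Delta$, a set $B\subset\Delta$ is an admissibly packed triangle at $p$ if there are $M\in\mathrm{SL}_2(\mathbb{Z})$ and $\lambda>0$ with $B=M(B(\lambda))+p$, and $B$ and $\Delta$ coincide in a small neighborhood of $p$. A packing of $\Delta$ is a (finite) union $P=\bigcup_i B_i$ of pairwise disjoint admissibly packed triangles in $\Delta$ (each packed at some vertex of $\Delta$). The toric packing density is $\rho_{\mathrm T}(\Delta)=\sup_P \operatorname{area}(P)/\operatorname{area}(\Delta)$, the supremum being over all packings $P$ of $\Delta$. *)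

theory Defs
  imports "HOL-Analysis.Analysis"
begin

definition real_vec :: "int^2 \<Rightarrow> real^2" where
  "real_vec u = (\<chi> i. real_of_int (u $ i))"

definition primitive_vec :: "int^2 \<Rightarrow> bool" where
  "primitive_vec u \<longleftrightarrow> coprime (u $ 1) (u $ 2)"

text \<open>The segment \<open>E\<close> emanates from its endpoint \<open>p\<close> in the direction \<open>u\<close>.\<close>

definition emanates :: "real^2 \<Rightarrow> int^2 \<Rightarrow> (real^2) set \<Rightarrow> bool" where
  "emanates p u E \<longleftrightarrow> (\<exists>t>0. E = closed_segment p (p + t *\<^sub>R real_vec u))"

text \<open>In the last clause the primitive directions \<open>u\<close>, \<open>v\<close> exist, and are uniquely
  determined by \<open>p\<close>, \<open>E\<close>, \<open>F\<close>, because of the clause before it; so quantifying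
  over them universally or existentially makes no difference.\<close>

definition delzant_polygon :: "(real^2) set \<Rightarrow> bool" where
  "delzant_polygon \<Delta> \<longleftrightarrow>
     polytope \<Delta> \<and> aff_dim \<Delta> = 2 \<and>
     (\<forall>E. E edge_of \<Delta> \<longrightarrow> (\<exists>p u. u \<noteq> 0 \<and> emanates p u E)) \<and>
     (\<forall>p E F u v. p extreme_point_of \<Delta> \<and> E edge_of \<Delta> \<and> F edge_of \<Delta> \<and> E \<noteq> F \<and>
        primitive_vec u \<and> primitive_vec v \<and> emanates p u E \<and> emanates p v F \<longrightarrow>
        \<bar>det (vector [u, v] :: int^2^2)\<bar> = 1)"

definition model_triangle :: "real \<Rightarrow> (real^2) set" where
  "model_triangle l = {v. v $ 1 \<ge> 0 \<and> v $ 2 \<ge> 0 \<and> v $ 1 + v $ 2 < l}"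

definition admissibly_packed :: "(real^2) set \<Rightarrow> real^2 \<Rightarrow> (real^2) set \<Rightarrow> bool" where
  "admissibly_packed \<Delta> p B \<longleftrightarrow>
     p extreme_point_of \<Delta> \<and> B \<subseteq> \<Delta> \<and>
     (\<exists>(M :: int^2^2) l. det M = 1 \<and> l > 0 \<and>
        B = (\<lambda>v. map_matrix real_of_int M *v v + p) ` model_triangle l) \<and>
     (\<exists>U. open U \<and> p \<in> U \<and> B \<inter> U = \<Delta> \<inter> U)"

definition toric_packing :: "(real^2) set \<Rightarrow> (real^2) set \<Rightarrow> bool" where
  "toric_packing \<Delta> P \<longleftrightarrow>
     (\<exists>\<B>. finite \<B> \<and> (\<forall>B\<in>\<B>. \<exists>p. admissibly_packed \<Delta> p B) \<and>
        pairwise disjnt \<B> \<and> P = \<Union>\<B>)"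

text \<open>The supremum is over a nonempty set (the empty packing is allowed) that is bounded
  by 1 whenever \<open>\<Delta>\<close> is compact, so \<open>Sup\<close> on the reals has its usual meaning there.\<close>

definition toric_density :: "(real^2) set \<Rightarrow> real" where
  "toric_density \<Delta> = (SUP P\<in>{P. toric_packing \<Delta> P}. measure lebesgue P / measure lebesgue \<Delta>)"

definition delzant_triangle :: "real \<Rightarrow> (real^2) set" where
  "delzant_triangle a = convex hull {vector [0, 0], vector [a, 0], vector [0, a]}"

definition rectangle :: "real \<Rightarrow> real \<Rightarrow> (real^2) set" where
  "rectangle a b = convex hull {vector [0, 0], vector [0, a], vector [b, a], vector [b, 0]}"

definition hirzebruch_trapezoid :: "real \<Rightarrow> real \<Rightarrow> nat \<Rightarrow> (real^2) set" where
  "hirzebruch_trapezoid a b n =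
     convex hull {vector [0, 0], vector [0, a], vector [b, a], vector [b + real n * a, 0]}"

end

theory Submission
  imports Defs
begin

text \<open>All three shapes are trapezoids with vertices \<open>(0,0)\<close>, \<open>(0,a)\<close>, \<open>(b,a)\<close>, \<open>(b+na,0)\<close>: the
  rectangle is the case \<open>n = 0\<close> and the triangle the case \<open>b = 0\<close>, \<open>n = 1\<close>. At a vertex of a Delzant
  polygon an admissibly packed triangle is determined by its size, because the integer matrices
  preserving the positive quadrant are the permutation matrices. Two triangles at adjacent vertices
  have sizes adding up to at most the affine length of the common edge, so the sizes
  \<open>w\<close>, \<open>x\<close>, \<open>y\<close>, \<open>z\<close> of a packing, in the order of the vertices above, satisfy \<open>w + x \<le> a\<close>, \<open>x + y \<le> b\<close>,
  \<open>y + z \<le> a\<close>, \<open>w + z \<le> b + na\<close>, and the packed area is half the sum of their squares. The maximum of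
  this convex quadratic form is attained with \<open>x = 0\<close>. For the Delzant triangle, where two of the
  vertices coincide, the packed triangle of size \<open>a\<close> at the origin already has full area.\<close>

section \<open>Trapezoids as intersections of half-planes; their area and dimension\<close>

lemma vec2_eq_iff: "v = w \<longleftrightarrow> v $ 1 = w $ 1 \<and> v $ 2 = w $ 2" for v w :: "'a ^ 2"
  by (simp add: vec_eq_iff forall_2)

lemma inner_vec2: "v \<bullet> w = v $ 1 * w $ 1 + v $ 2 * w $ 2" for v w :: "real ^ 2"
  by (simp add: inner_vec_def sum_2)

lemma real_vec_nth [simp]: "real_vec u $ i = real_of_int (u $ i)"
  by (simp add: real_vec_def)

lemma real_vec_uminus: "real_vec (- u) = - real_vec u"
  by (simp add: vec_eq_iff)

text \<open>The horizontal chord through a point satisfying the inequalities ends on the left and on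
  the slanted side. Both ends are convex combinations of vertices, and the point is a convex
  combination of the ends. Admitting \<open>b = 0\<close> covers the Delzant triangle.\<close>

lemma hirzebruch_trapezoid_eq:
  assumes "0 < a" "0 \<le> b"
  shows "hirzebruch_trapezoid a b n =
    {v. 0 \<le> v $ 1 \<and> 0 \<le> v $ 2 \<and> v $ 2 \<le> a \<and> v $ 1 + real n * v $ 2 \<le> b + real n * a}"
    (is "_ = ?H")
proof
  have H: "?H = {v. vector [-1, 0] \<bullet> v \<le> 0} \<inter> {v. vector [0, -1] \<bullet> v \<le> 0} \<inter>
      {v. vector [0, 1] \<bullet> v \<le> a} \<inter> {v. vector [1, real n] \<bullet> v \<le> b + real n * a}"
    by (auto simp: inner_vec2)
  have "convex ?H"
    unfolding H by (intro convex_Int convex_halfspace_le)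
  then show "hirzebruch_trapezoid a b n \<subseteq> ?H"
    unfolding hirzebruch_trapezoid_def using assms by (intro hull_minimal) auto
next
  let ?T = "hirzebruch_trapezoid a b n"
  have conv: "convex ?T"
    by (simp add: hirzebruch_trapezoid_def)
  have vs: "vector [0, 0] \<in> ?T" "vector [0, a] \<in> ?T" "vector [b, a] \<in> ?T"
      "vector [b + real n * a, 0] \<in> ?T"
    by (simp_all add: hirzebruch_trapezoid_def hull_inc)
  show "?H \<subseteq> ?T"
  proof clarify
    fix v :: "real ^ 2"
    assume v: "0 \<le> v $ 1" "0 \<le> v $ 2" "v $ 2 \<le> a" "v $ 1 + real n * v $ 2 \<le> b + real n * a"
    define t where "t = v $ 2 / a"
    have t: "0 \<le> t" "t \<le> 1" "v $ 2 = t * a"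
      using v assms by (auto simp: t_def)
    \<comment> \<open>\<open>r\<close> is the abscissa of the slanted side at height
      \<open>v $ 2\<close>, that is, the length of the chord.\<close>
    define r where "r = b + real n * (a - v $ 2)"
    have r: "0 \<le> v $ 1" "v $ 1 \<le> r"
      using v by (auto simp: r_def algebra_simps)
    have "(1 - t) *\<^sub>R vector [0, 0] + t *\<^sub>R vector [0, a] \<in> ?T"
      using t vs by (intro convexD [OF conv]) auto
    moreover have "(1 - t) *\<^sub>R vector [0, 0] + t *\<^sub>R vector [0, a] = (vector [0, v $ 2] :: real ^ 2)"
      by (simp add: vec2_eq_iff t)
    ultimately have L: "vector [0, v $ 2] \<in> ?T"
      by simp
    have "(1 - t) *\<^sub>R vector [b + real n * a, 0] + t *\<^sub>R vector [b, a] \<in> ?T"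
      using t vs by (intro convexD [OF conv]) auto
    moreover have "(1 - t) *\<^sub>R vector [b + real n * a, 0] + t *\<^sub>R vector [b, a]
        = (vector [r, v $ 2] :: real ^ 2)"
      by (simp add: vec2_eq_iff t r_def algebra_simps)
    ultimately have R: "vector [r, v $ 2] \<in> ?T"
      by simp
    show "v \<in> ?T"
    \<comment> \<open>The chord can shrink to a point, as at the apex of the Delzant triangle;
      otherwise \<open>v\<close> divides it in the ratio given by \<open>v $ 1 / r\<close>.\<close>
    proof (cases "r = 0")
      case True
      then have "v = vector [0, v $ 2]"
        using r by (simp add: vec2_eq_iff)
      with L show ?thesis by simp
    next
      case False
      define s where "s = v $ 1 / r"
      have s: "0 \<le> s" "s \<le> 1" "v $ 1 = s * r"
        using r False by (auto simp: s_def)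
      have "(1 - s) *\<^sub>R vector [0, v $ 2] + s *\<^sub>R vector [r, v $ 2] \<in> ?T"
        using s L R by (intro convexD [OF conv]) auto
      moreover have "(1 - s) *\<^sub>R vector [0, v $ 2] + s *\<^sub>R vector [r, v $ 2] = v"
        by (simp add: vec2_eq_iff s algebra_simps)
      ultimately show ?thesis by simp
    qed
  qed
qed

lemma rectangle_eq_trapezoid: "rectangle a b = hirzebruch_trapezoid a b 0"
  by (simp add: rectangle_def hirzebruch_trapezoid_def)

lemma delzant_triangle_eq_trapezoid: "delzant_triangle a = hirzebruch_trapezoid a 0 1"
proof -
  have "{vector [0, 0], vector [a, 0], vector [0, a]} =
      {vector [0, 0], vector [0, a], vector [a, 0] :: real ^ 2}"
    by blast
  then have "delzant_triangle a = convex hull {vector [0, 0], vector [0, a], vector [a, 0]}"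
    by (simp only: delzant_triangle_def)
  then show ?thesis
    by (simp add: hirzebruch_trapezoid_def)
qed

lemma polytope_trapezoid: "polytope (hirzebruch_trapezoid a b n)"
  unfolding hirzebruch_trapezoid_def by (simp add: polytope_convex_hull)

lemma lmeasurable_trapezoid: "hirzebruch_trapezoid a b n \<in> lmeasurable"
  by (simp add: polytope_trapezoid polytope_imp_compact lmeasurable_compact)

text \<open>The trapezoid and its reflection in the midpoint of the slanted side tile a box.\<close>

lemma measure_trapezoid:
  assumes "0 < a" "0 \<le> b"
  shows "measure lebesgue (hirzebruch_trapezoid a b n) = a * (2 * b + real n * a) / 2"
proof -
  let ?T = "hirzebruch_trapezoid a b n"
  define c :: "real ^ 2" where "c = vector [2 * b + real n * a, a]"
  let ?R = "(\<lambda>v. (-1) *\<^sub>R v + c) ` ?T"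
  have measR: "?R \<in> lmeasurable"
    by (intro lmeasurable_compact compact_continuous_image continuous_intros)
       (simp add: polytope_trapezoid polytope_imp_compact)
  have memR: "v \<in> ?R \<longleftrightarrow> c - v \<in> ?T" for v :: "real ^ 2"
    by (force simp: image_iff intro: bexI [of _ "c - v"])
  have un: "?T \<union> ?R = cbox (vector [0, 0]) c"
  proof (rule set_eqI)
    fix v :: "real ^ 2"
    define m where "m = real n * v $ 2"
    have "real n * (a - v $ 2) = real n * a - m"
      by (simp add: m_def algebra_simps)
    moreover have "m \<le> real n * a" if "v $ 2 \<le> a"
      using that by (auto simp: m_def intro: mult_left_mono)
    moreover have "0 \<le> m" if "0 \<le> v $ 2"
      using that by (auto simp: m_def)
    ultimately show "v \<in> ?T \<union> ?R \<longleftrightarrow> v \<in> cbox (vector [0, 0]) c"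
      unfolding Un_iff memR using assms
      by (auto simp: hirzebruch_trapezoid_eq c_def mem_box_cart forall_2 mult.commute [of a]
          simp flip: m_def)
  qed
  have "?T \<inter> ?R \<subseteq> {v. vector [1, real n] \<bullet> v = b + real n * a}"
    unfolding Int_def memR using assms
    by (auto simp: hirzebruch_trapezoid_eq c_def inner_vec2 algebra_simps)
  moreover have "negligible {v :: real ^ 2. vector [1, real n] \<bullet> v = b + real n * a}"
    by (rule negligible_hyperplane) (simp add: vec2_eq_iff)
  ultimately have neg: "negligible (?T \<inter> ?R)"
    by (metis negligible_subset)
  have "measure lebesgue (?T \<union> ?R) = measure lebesgue ?T + measure lebesgue ?R"
    using measure_Un3_negligible [of ?T ?R "{}" "?T \<union> ?R"] neg lmeasurable_trapezoid measR
    by simp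
  also have "measure lebesgue ?R = measure lebesgue ?T"
    using measure_lebesgue_affine [of "-1" c ?T] by simp
  finally have "2 * measure lebesgue ?T = measure lebesgue (cbox (vector [0, 0]) c)"
    using un by simp
  also have "\<dots> = measure lborel (cbox (vector [0, 0]) c)"
    by (simp add: measure_completion)
  also have "\<dots> = (2 * b + real n * a) * a"
    using assms
    by (subst content_cbox_cart) (auto simp: UNIV_2 c_def box_ne_empty cbox_interval interval_ne_empty_cart forall_2 less_eq_vec_def)
  finally show ?thesis
    by (simp add: algebra_simps)
qed

text \<open>Positive area gives a convex set nonempty interior. The last hypothesis rules out the
  rectangle of width zero.\<close>

lemma aff_dim_trapezoid:
  assumes "0 < a" "0 \<le> b" "b = 0 \<longrightarrow> 0 < n"
  shows "aff_dim (hirzebruch_trapezoid a b n) = 2"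
proof -
  have "0 < 2 * b + real n * a"
    using assms by (cases "b = 0") (auto simp: add_pos_nonneg)
  then have "\<not> negligible (hirzebruch_trapezoid a b n)"
    using assms by (auto simp: negligible_iff_measure measure_trapezoid)
  then have "interior (hirzebruch_trapezoid a b n) \<noteq> {}"
    by (simp add: negligible_convex_interior polytope_imp_convex polytope_trapezoid)
  from aff_dim_nonempty_interior [OF this] show ?thesis
    by simp
qed

section \<open>Edges of the trapezoid and the Delzant condition\<close>

text \<open>The supporting line cuts out a face of \<open>S\<close>; touching \<open>E\<close> in a
  relative interior point, it contains all of \<open>E\<close>. Were the inclusion strict,
  \<open>E\<close> would be a proper face of a set inside a line and so have dimension below
  1.\<close>

lemma edge_eq_supporting_side:
  fixes S :: "(real ^ 2) set"
  assumes "convex S" "E edge_of S" "x \<in> rel_interior E"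
    and "c \<noteq> 0" "\<And>v. v \<in> S \<Longrightarrow> c \<bullet> v \<le> d" "c \<bullet> x = d"
  shows "E = S \<inter> {v. c \<bullet> v = d}"
proof (rule ccontr)
  assume ne: "E \<noteq> S \<inter> {v. c \<bullet> v = d}"
  have E: "E face_of S" "aff_dim E = 1"
    using assms(2) by (auto simp: edge_of_def)
  have F: "(S \<inter> {v. c \<bullet> v = d}) face_of S"
    using assms by (intro face_of_Int_supporting_hyperplane_le) auto
  have "x \<in> S"
    using assms(3) E(1) rel_interior_subset face_of_imp_subset by blast
  then have "E \<subseteq> S \<inter> {v. c \<bullet> v = d}"
    using assms E by (intro subset_of_face_of [OF F]) (auto simp: face_of_imp_subset)
  with E have "E face_of (S \<inter> {v. c \<bullet> v = d})"
    using face_of_subset [of E S] by auto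
  then have "aff_dim E < aff_dim (S \<inter> {v. c \<bullet> v = d})"
    using ne assms(1) by (intro face_of_aff_dim_lt convex_Int convex_hyperplane)
  also have "\<dots> \<le> aff_dim {v. c \<bullet> v = d}"
    by (intro aff_dim_subset) auto
  also have "\<dots> = 1"
    using assms(4) by simp
  finally show False
    using E by simp
qed

lemma closed_segment_ray:
  assumes "0 \<le> t"
  shows "closed_segment p (p + t *\<^sub>R w) = {p + s *\<^sub>R w | s. 0 \<le> s \<and> s \<le> t}"
proof -
  have "(1 - u) *\<^sub>R p + u *\<^sub>R (p + t *\<^sub>R w) = p + (u * t) *\<^sub>R w" for u
    by (simp add: algebra_simps)
  then have "closed_segment p (p + t *\<^sub>R w) = {p + (u * t) *\<^sub>R w | u. 0 \<le> u \<and> u \<le> 1}"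
    by (simp add: closed_segment_def conj_ac)
  also have "\<dots> = {p + s *\<^sub>R w | s. 0 \<le> s \<and> s \<le> t}"
  proof safe
    fix u :: real assume "0 \<le> u" "u \<le> 1"
    then show "\<exists>s. p + (u * t) *\<^sub>R w = p + s *\<^sub>R w \<and> 0 \<le> s \<and> s \<le> t"
      using assms by (intro exI [of _ "u * t"]) (auto intro: mult_left_le_one_le)
  next
    fix s assume "0 \<le> s" "s \<le> t"
    then show "\<exists>u. p + s *\<^sub>R w = p + (u * t) *\<^sub>R w \<and> 0 \<le> u \<and> u \<le> 1"
      using assms by (intro exI [of _ "s / t"]) (auto simp: divide_le_eq)
  qed
  finally show ?thesis .
qed

text \<open>A relative interior point of an edge is not interior to the polygon, so one of the four
  defining inequalities is an equality there. The edge is then the whole side on that line.\<close>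

lemma trapezoid_edges:
  assumes "0 < a" "0 \<le> b" "b = 0 \<longrightarrow> 0 < n" and E: "E edge_of hirzebruch_trapezoid a b n"
  obtains p w t where "0 < t" "E = closed_segment p (p + t *\<^sub>R real_vec w)"
    "(p, w, t) \<in> {(vector [0, 0], vector [0, 1], a), (vector [0, 0], vector [1, 0], b + real n * a),
       (vector [0, a], vector [1, 0], b), (vector [b, a], vector [int n, -1], a)}"
proof -
  let ?T = "hirzebruch_trapezoid a b n"
  note T = hirzebruch_trapezoid_eq [OF assms(1,2), of n]
  have conv: "convex ?T"
    by (simp add: polytope_imp_convex polytope_trapezoid)
  have faceE: "E face_of ?T" "aff_dim E = 1"
    using E by (auto simp: edge_of_def)
  then have "E \<noteq> ?T"
    using aff_dim_trapezoid assms by force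
  have "convex E" "E \<noteq> {}"
    using faceE face_of_imp_convex by force+
  then obtain x where x: "x \<in> rel_interior E"
    using rel_interior_eq_empty by blast
  then have xT: "x \<in> ?T"
    using rel_interior_subset face_of_imp_subset [OF faceE(1)] by blast
  have "x \<notin> interior ?T"
    using face_of_disjoint_rel_interior [OF faceE(1) \<open>E \<noteq> ?T\<close>] x rel_interior_subset
      interior_subset_rel_interior by blast
  moreover have "{v. 0 < v $ 1 \<and> 0 < v $ 2 \<and> v $ 2 < a \<and> v $ 1 + real n * v $ 2 < b + real n * a}
      \<subseteq> interior ?T"
    by (rule interior_maximal) (auto simp: T intro!: open_Collect_conj open_Collect_less continuous_intros)
  ultimately have "x $ 1 = 0 \<or> x $ 2 = 0 \<or> x $ 2 = a \<or> x $ 1 + real n * x $ 2 = b + real n * a"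
    using xT by (force simp: T)
  then obtain p w t where ptw:
    "(p, w, t) \<in> {(vector [0, 0], vector [0, 1], a), (vector [0, 0], vector [1, 0], b + real n * a),
       (vector [0, a], vector [1, 0], b), (vector [b, a], vector [int n, -1], a)}"
    and "E = {p + s *\<^sub>R real_vec w | s. 0 \<le> s \<and> s \<le> t}"
  proof (elim disjE)
    assume *: "x $ 1 = 0"
    have "E = ?T \<inter> {v. vector [-1, 0] \<bullet> v = 0}"
      by (rule edge_eq_supporting_side [OF conv E x]) (auto simp: T inner_vec2 vec2_eq_iff *)
    also have "\<dots> = {vector [0, 0] + s *\<^sub>R real_vec (vector [0, 1]) | s. 0 \<le> s \<and> s \<le> a}"
      using assms(1,2) by (auto simp: T inner_vec2 vec2_eq_iff intro!: add_increasing mult_left_mono)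
    finally show ?thesis by (intro that) auto
  next
    assume *: "x $ 2 = 0"
    have "E = ?T \<inter> {v. vector [0, -1] \<bullet> v = 0}"
      by (rule edge_eq_supporting_side [OF conv E x]) (auto simp: T inner_vec2 vec2_eq_iff *)
    also have "\<dots> = {vector [0, 0] + s *\<^sub>R real_vec (vector [1, 0]) | s. 0 \<le> s \<and> s \<le> b + real n * a}"
      using assms(1,2) by (auto simp: T inner_vec2 vec2_eq_iff)
    finally show ?thesis by (intro that) auto
  next
    assume *: "x $ 2 = a"
    have "E = ?T \<inter> {v. vector [0, 1] \<bullet> v = a}"
      by (rule edge_eq_supporting_side [OF conv E x]) (auto simp: T inner_vec2 vec2_eq_iff *)
    also have "\<dots> = {vector [0, a] + s *\<^sub>R real_vec (vector [1, 0]) | s. 0 \<le> s \<and> s \<le> b}"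
      using assms(1,2) by (auto simp: T inner_vec2 vec2_eq_iff)
    finally show ?thesis by (intro that) auto
  next
    assume *: "x $ 1 + real n * x $ 2 = b + real n * a"
    have "E = ?T \<inter> {v. vector [1, real n] \<bullet> v = b + real n * a}"
      by (rule edge_eq_supporting_side [OF conv E x]) (auto simp: T inner_vec2 vec2_eq_iff *)
    also have "\<dots> = {vector [b, a] + s *\<^sub>R real_vec (vector [int n, -1]) | s. 0 \<le> s \<and> s \<le> a}"
    proof safe
      fix v assume "v \<in> ?T" "vector [1, real n] \<bullet> v = b + real n * a"
      then show "\<exists>s. v = vector [b, a] + s *\<^sub>R real_vec (vector [int n, -1]) \<and> 0 \<le> s \<and> s \<le> a"
        by (intro exI [of _ "a - v $ 2"]) (auto simp: T inner_vec2 vec2_eq_iff algebra_simps)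
    qed (use assms(1,2) in \<open>auto simp: T inner_vec2 algebra_simps\<close>)
    finally show ?thesis by (intro that) auto
  qed
  moreover have "0 \<le> t"
    using ptw assms by auto
  ultimately have E_eq: "E = closed_segment p (p + t *\<^sub>R real_vec w)"
    by (simp add: closed_segment_ray)
  \<comment> \<open>The dimension of an edge excludes the upper side when \<open>b = 0\<close>,
    where it has collapsed to a point.\<close>
  with faceE have "t \<noteq> 0"
    by auto
  with \<open>0 \<le> t\<close> E_eq ptw show ?thesis
    by (intro that [of t p w]) auto
qed

text \<open>Parallel vectors have vanishing cross product, and for coprime entries this forces equal
  absolute values; positivity of \<open>s\<close> and \<open>t\<close> fixes the signs.\<close>

lemma primitive_vec_unique:
  assumes "primitive_vec u" "primitive_vec w" "0 < s" "0 < t" "s *\<^sub>R real_vec u = t *\<^sub>R real_vec w"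
  shows "u = w"
proof -
  have eq: "s * real_of_int (u $ 1) = t * real_of_int (w $ 1)"
      "s * real_of_int (u $ 2) = t * real_of_int (w $ 2)"
    using assms(5) by (auto simp: vec2_eq_iff)
  have "(s * t) * (real_of_int (u $ 1) * real_of_int (w $ 2))
      = (s * t) * (real_of_int (w $ 1) * real_of_int (u $ 2))"
    using eq by (metis (no_types, opaque_lifting) mult.assoc mult.left_commute mult.commute)
  then have "real_of_int (u $ 1 * w $ 2) = real_of_int (w $ 1 * u $ 2)"
    using assms by simp
  then have "u $ 1 * w $ 2 = w $ 1 * u $ 2"
    by (metis of_int_eq_iff)
  then have "\<bar>u $ 1\<bar> * \<bar>w $ 2\<bar> = \<bar>w $ 1\<bar> * \<bar>u $ 2\<bar>"
    by (metis abs_mult)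
  then have "\<bar>u $ 1\<bar> = \<bar>w $ 1\<bar>" "\<bar>u $ 2\<bar> = \<bar>w $ 2\<bar>"
    using assms(1,2) coprime_crossproduct_int [of "u $ 1" "u $ 2" "w $ 1" "w $ 2"]
    by (auto simp: primitive_vec_def)
  moreover have "sgn (u $ i) = sgn (w $ i)" for i
  proof -
    have "s * real_of_int (u $ i) = t * real_of_int (w $ i)"
      using assms(5) by (auto simp: vec_eq_iff)
    then have "sgn (s * real_of_int (u $ i)) = sgn (t * real_of_int (w $ i))"
      by simp
    then show ?thesis
      using assms(3,4) by (auto simp: sgn_mult sgn_if zero_less_mult_iff split: if_splits)
  qed
  ultimately show ?thesis
    by (metis mult_sgn_abs vec2_eq_iff)
qed

text \<open>A segment determines its two endpoints, so \<open>q\<close> is one of them. Seen from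
  the far end the direction is reversed, and primitivity fixes its length.\<close>

lemma emanates_closed_segment:
  assumes "emanates q u (closed_segment p (p + t *\<^sub>R real_vec w))" "0 < t"
    and "primitive_vec u" "primitive_vec w"
  shows "q = p \<and> u = w \<or> q = p + t *\<^sub>R real_vec w \<and> u = - w"
proof -
  obtain s where "0 < s"
    and "closed_segment p (p + t *\<^sub>R real_vec w) = closed_segment q (q + s *\<^sub>R real_vec u)"
    using assms(1) by (auto simp: emanates_def)
  then have "{p, p + t *\<^sub>R real_vec w} = {q, q + s *\<^sub>R real_vec u}"
    by simp
  then have "p = q \<and> p + t *\<^sub>R real_vec w = q + s *\<^sub>R real_vec u \<or>
      p = q + s *\<^sub>R real_vec u \<and> p + t *\<^sub>R real_vec w = q"
    by (simp only: doubleton_eq_iff)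
  then consider "q = p" "q + s *\<^sub>R real_vec u = p + t *\<^sub>R real_vec w"
    | "q = p + t *\<^sub>R real_vec w" "q + s *\<^sub>R real_vec u = p"
    by metis
  then show ?thesis
  proof cases
    case 1
    then have "s *\<^sub>R real_vec u = t *\<^sub>R real_vec w"
      by simp
    with 1 show ?thesis
      using primitive_vec_unique assms \<open>0 < s\<close> by blast
  next
    case 2
    then have "s *\<^sub>R real_vec u = t *\<^sub>R real_vec (- w)"
      by (auto simp: real_vec_uminus add.assoc add_eq_0_iff)
    moreover have "primitive_vec (- w)"
      using assms(4) by (simp add: primitive_vec_def)
    ultimately show ?thesis
      using 2 primitive_vec_unique assms \<open>0 < s\<close> by blast
  qed
qed

text \<open>A finite check. A row of the table holds the number of a side (left, bottom, top,
  slanted), one of its ends and the primitive direction leaving that end, so each side occurs twice.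
  If \<open>b = 0\<close>, the left and slanted sides meet at \<open>(0, a)\<close> with determinant
  \<open>n\<close> up to sign, whence the condition \<open>n = 1\<close>.\<close>

lemma adjacent_sides_det:
  fixes a b :: real and u v :: "int ^ 2"
  assumes "0 < a" "0 \<le> b" "b = 0 \<longrightarrow> n = 1" "i \<noteq> j" "i = 2 \<or> j = 2 \<longrightarrow> 0 < b"
    and "(i, x, y, u $ 1, u $ 2) \<in> {(0::nat, 0, 0, 0, 1), (0, 0, a, 0, -1),
       (1, 0, 0, 1, 0), (1, b + real n * a, 0, -1, 0), (2, 0, a, 1, 0), (2, b, a, -1, 0),
       (3, b, a, int n, -1), (3, b + real n * a, 0, - int n, 1)}"
    and "(j, x, y, v $ 1, v $ 2) \<in> {(0::nat, 0, 0, 0, 1), (0, 0, a, 0, -1),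
       (1, 0, 0, 1, 0), (1, b + real n * a, 0, -1, 0), (2, 0, a, 1, 0), (2, b, a, -1, 0),
       (3, b, a, int n, -1), (3, b + real n * a, 0, - int n, 1)}"
  shows "\<bar>det (vector [u, v] :: int ^ 2 ^ 2)\<bar> = 1"
proof -
  have "0 < b + real n * a"
    using assms by (cases "b = 0") (auto simp: add_pos_nonneg)
  with assms show ?thesis
    by (simp add: det_2) (elim disjE conjE; simp)
qed

lemma delzant_polygon_trapezoid:
  assumes "0 < a" "0 \<le> b" "b = 0 \<longrightarrow> n = 1"
  shows "delzant_polygon (hirzebruch_trapezoid a b n)"
proof -
  let ?T = "hirzebruch_trapezoid a b n"
  let ?S = "{(vector [0, 0], vector [0, 1], a), (vector [0, 0], vector [1, 0], b + real n * a),
       (vector [0, a], vector [1, 0], b), (vector [b, a], vector [int n, -1], a)}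
     :: ((real ^ 2) \<times> (int ^ 2) \<times> real) set"
  have edges: "\<exists>p w t. 0 < t \<and> E = closed_segment p (p + t *\<^sub>R real_vec w) \<and> (p, w, t) \<in> ?S"
    if "E edge_of ?T" for E
  proof -
    have "b = 0 \<longrightarrow> 0 < n"
      using assms(3) by auto
    from trapezoid_edges [OF assms(1,2) this that] show ?thesis
      by metis
  qed
  have prim: "primitive_vec w" if "(p, w, t) \<in> ?S" for p w t
    using that by (auto simp: primitive_vec_def)
  have direction: "\<exists>p u. u \<noteq> 0 \<and> emanates p u E" if "E edge_of ?T" for E
    using edges [OF that] prim unfolding emanates_def
    by (metis coprime_0_left_iff not_is_unit_0 primitive_vec_def zero_index)
  have smooth: "\<bar>det (vector [u, v] :: int ^ 2 ^ 2)\<bar> = 1"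
    if E: "E edge_of ?T" "F edge_of ?T" "E \<noteq> F" "primitive_vec u" "primitive_vec v"
      "emanates q u E" "emanates q v F" for q E F u v
  proof -
    \<comment> \<open>Numbering the sides turns distinct edges into distinct indices, so the
      determinant condition becomes the finite check of \<open>adjacent_sides_det\<close> on the
      table \<open>V\<close>.\<close>
    define side :: "nat \<Rightarrow> (real ^ 2) set" where
      "side i = (if i = 0 then closed_segment (vector [0, 0]) (vector [0, 0] + a *\<^sub>R real_vec (vector [0, 1]))
        else if i = 1 then closed_segment (vector [0, 0]) (vector [0, 0] + (b + real n * a) *\<^sub>R real_vec (vector [1, 0]))
        else if i = 2 then closed_segment (vector [0, a]) (vector [0, a] + b *\<^sub>R real_vec (vector [1, 0]))
        else closed_segment (vector [b, a]) (vector [b, a] + a *\<^sub>R real_vec (vector [int n, -1])))" for i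
    define V :: "(nat \<times> real \<times> real \<times> int \<times> int) set" where
      "V = {(0, 0, 0, 0, 1), (0, 0, a, 0, -1),
         (1, 0, 0, 1, 0), (1, b + real n * a, 0, -1, 0), (2, 0, a, 1, 0), (2, b, a, -1, 0),
         (3, b, a, int n, -1), (3, b + real n * a, 0, - int n, 1)}"
    have side: "\<exists>i. E = side i \<and> (i = 2 \<longrightarrow> 0 < b) \<and> (i, q $ 1, q $ 2, u $ 1, u $ 2) \<in> V"
      if asm: "E edge_of ?T" "primitive_vec u" "emanates q u E" for E u
    proof -
      obtain p w t where p: "0 < t" "E = closed_segment p (p + t *\<^sub>R real_vec w)" "(p, w, t) \<in> ?S"
        using edges [OF asm(1)] by blast
      have qu: "q = p \<and> u = w \<or> q = p + t *\<^sub>R real_vec w \<and> u = - w"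
        using emanates_closed_segment p prim [OF p(3)] asm by blast
      consider "(p, w, t) = (vector [0, 0], vector [0, 1], a)"
        | "(p, w, t) = (vector [0, 0], vector [1, 0], b + real n * a)"
        | "(p, w, t) = (vector [0, a], vector [1, 0], b)"
        | "(p, w, t) = (vector [b, a], vector [int n, -1], a)"
        using p(3) by blast
      then show ?thesis
      proof cases
        case 1
        with qu p show ?thesis
          by (intro exI [of _ 0]) (auto simp: side_def V_def)
      next
        case 2
        with qu p show ?thesis
          by (intro exI [of _ 1]) (auto simp: side_def V_def)
      next
        case 3
        with qu p show ?thesis
          by (intro exI [of _ 2]) (auto simp: side_def V_def)
      next
        case 4
        with qu p show ?thesis
          by (intro exI [of _ 3]) (auto simp: side_def V_def)
      qed
    qed
    obtain i where i: "E = side i" "i = 2 \<longrightarrow> 0 < b" "(i, q $ 1, q $ 2, u $ 1, u $ 2) \<in> V"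
      using side [OF E(1,4,6)] by blast
    obtain j where j: "F = side j" "j = 2 \<longrightarrow> 0 < b" "(j, q $ 1, q $ 2, v $ 1, v $ 2) \<in> V"
      using side [OF E(2,5,7)] by blast
    have "i \<noteq> j" "i = 2 \<or> j = 2 \<longrightarrow> 0 < b"
      using i j \<open>E \<noteq> F\<close> by auto
    then show ?thesis
      using adjacent_sides_det [OF assms _ _ i(3)[unfolded V_def] j(3)[unfolded V_def]] by blast
  qed
  show ?thesis
    unfolding delzant_polygon_def
  proof (intro conjI allI impI)
    show "aff_dim ?T = 2"
      using aff_dim_trapezoid assms by auto
  next
    fix q E F and u v :: "int ^ 2"
    assume "q extreme_point_of ?T \<and> E edge_of ?T \<and> F edge_of ?T \<and> E \<noteq> F \<and>
      primitive_vec u \<and> primitive_vec v \<and> emanates q u E \<and> emanates q v F"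
    then show "\<bar>det (vector [u, v] :: int ^ 2 ^ 2)\<bar> = 1"
      by (elim conjE) (rule smooth)
  qed (fact polytope_trapezoid direction)+
qed

section \<open>Area of model triangles and of their unimodular images\<close>

lemma matrix_vector_mult_nth2:
  "(A *v v) $ i = A $ i $ 1 * v $ 1 + A $ i $ 2 * v $ 2" for A :: "'a::semiring_1 ^ 2 ^ 'n"
  by (simp add: matrix_vector_mult_def sum_2)

lemma det_real_of_int: "det (map_matrix real_of_int K) = real_of_int (det K)" for K :: "int ^ 2 ^ 2"
  by (simp add: det_2)

lemma model_triangle_empty: "l \<le> 0 \<Longrightarrow> model_triangle l = {}"
  by (auto simp: model_triangle_def)

text \<open>The half-open triangle differs from the closed trapezoid with \<open>b = 0\<close> and
  \<open>n = 1\<close> only on the line of the hypotenuse, a null set.\<close>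

lemma measure_model_triangle:
  assumes "0 \<le> l"
  shows "model_triangle l \<in> lmeasurable" "measure lebesgue (model_triangle l) = l\<^sup>2 / 2"
proof -
  have "model_triangle l \<in> lmeasurable \<and> measure lebesgue (model_triangle l) = l\<^sup>2 / 2"
  proof (cases "l = 0")
    case True
    then show ?thesis by (simp add: model_triangle_empty)
  next
    case False
    then have l: "0 < l" using assms by simp
    let ?T = "hirzebruch_trapezoid l 0 1"
    have T: "?T = {v. 0 \<le> v $ 1 \<and> 0 \<le> v $ 2 \<and> v $ 2 \<le> l \<and> v $ 1 + v $ 2 \<le> l}"
      using l by (simp add: hirzebruch_trapezoid_eq)
    have "(?T - model_triangle l) \<union> (model_triangle l - ?T) \<subseteq> {v. vector [1, 1] \<bullet> v = l}"
      unfolding T by (auto simp: model_triangle_def inner_vec2)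
    moreover have "negligible {v :: real ^ 2. vector [1, 1] \<bullet> v = l}"
      by (rule negligible_hyperplane) (simp add: vec2_eq_iff)
    ultimately have "negligible ((?T - model_triangle l) \<union> (model_triangle l - ?T))"
      by (metis negligible_subset)
    then have "model_triangle l \<in> lmeasurable"
      and "measure lebesgue (model_triangle l) = measure lebesgue ?T"
      using lmeasurable_negligible_symdiff [OF lmeasurable_trapezoid]
        measure_negligible_symdiff [OF lmeasurable_trapezoid] by (metis, metis)
    then show ?thesis
      using l by (simp add: measure_trapezoid power2_eq_square)
  qed
  then show "model_triangle l \<in> lmeasurable" "measure lebesgue (model_triangle l) = l\<^sup>2 / 2"
    by auto
qed

lemma measure_moved_model_triangle:
  fixes M :: "int ^ 2 ^ 2"
  assumes "det M = 1" "0 \<le> l"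
  shows "(\<lambda>v. map_matrix real_of_int M *v v + p) ` model_triangle l \<in> lmeasurable" (is "?B \<in> _")
    and "measure lebesgue ((\<lambda>v. map_matrix real_of_int M *v v + p) ` model_triangle l) = l\<^sup>2 / 2"
proof -
  let ?f = "(*v) (map_matrix real_of_int M)"
  have B: "?B = (+) p ` ?f ` model_triangle l"
    by (simp add: image_image add.commute)
  have "linear ?f" by simp
  note lin = measurable_linear_image [OF this] measure_linear_image [OF this]
  have f: "?f ` model_triangle l \<in> lmeasurable"
    using assms measure_model_triangle by (intro lin)
  then show "?B \<in> lmeasurable"
    unfolding B by (rule measurable_translation)
  show "measure lebesgue ?B = l\<^sup>2 / 2"
    unfolding B measure_translation using assms
    by (simp add: lin measure_model_triangle det_real_of_int)
qed

section \<open>Corner coordinates and corner triangles\<close>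

definition corner_coords :: "int ^ 2 ^ 2 \<Rightarrow> real ^ 2 \<Rightarrow> real ^ 2 \<Rightarrow> real ^ 2" where
  "corner_coords K p v = map_matrix real_of_int K *v (v - p)"

text \<open>Here \<open>K\<close> maps the polygon's corner to the model corner, opposite to the
  direction of \<open>M\<close> in \<open>admissibly_packed\<close>. As a preimage, the triangle has
  membership given by linear inequalities.\<close>

definition corner_triangle :: "int ^ 2 ^ 2 \<Rightarrow> real ^ 2 \<Rightarrow> real \<Rightarrow> (real ^ 2) set" where
  "corner_triangle K p l = {v. corner_coords K p v \<in> model_triangle l}"

text \<open>The determinant may be \<open>-1\<close> because neither edge at a corner is singled out
  as the first; the frames used below at the second and fourth vertex of the trapezoid reverse
  orientation.\<close>

definition smooth_corner :: "(real ^ 2) set \<Rightarrow> int ^ 2 ^ 2 \<Rightarrow> real ^ 2 \<Rightarrow> bool" where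
  "smooth_corner S K p \<longleftrightarrow> \<bar>det K\<bar> = 1 \<and>
     (\<forall>v\<in>S. 0 \<le> corner_coords K p v $ 1 \<and> 0 \<le> corner_coords K p v $ 2) \<and>
     (\<exists>U. open U \<and> p \<in> U \<and>
       (\<forall>v\<in>U. 0 \<le> corner_coords K p v $ 1 \<and> 0 \<le> corner_coords K p v $ 2 \<longrightarrow> v \<in> S))"

lemma corner_coords_nth:
  "corner_coords K p v $ i =
    real_of_int (K $ i $ 1) * (v $ 1 - p $ 1) + real_of_int (K $ i $ 2) * (v $ 2 - p $ 2)"
  by (simp add: corner_coords_def matrix_vector_mult_nth2)

lemma corner_coords_eq_iff:
  assumes "\<bar>det K\<bar> = 1"
  shows "corner_coords K p v = corner_coords K p w \<longleftrightarrow> v = w"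
proof -
  have "det (map_matrix real_of_int K) \<noteq> 0"
    using assms by (auto simp: det_real_of_int)
  then have "inj ((*v) (map_matrix real_of_int K))"
    by (simp add: inj_matrix_vector_mult invertible_det_nz)
  then show ?thesis
    by (simp add: corner_coords_def inj_eq)
qed

lemma corner_coords_surj:
  assumes "\<bar>det K\<bar> = 1"
  obtains v where "corner_coords K p v = z"
proof -
  have "det (map_matrix real_of_int K) \<noteq> 0"
    using assms by (auto simp: det_real_of_int)
  then have "invertible (map_matrix real_of_int K)"
    by (simp add: invertible_det_nz)
  then obtain A where "map_matrix real_of_int K ** A = mat 1"
    by (auto simp: invertible_def)
  then have "corner_coords K p (A *v z + p) = z"
    by (simp add: corner_coords_def matrix_vector_mul_assoc)
  then show ?thesis by (rule that)
qed

text \<open>A corner with \<open>det K = -1\<close> is moved onto the model corner by \<open>K\<close> followed by the swap of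
  the two coordinates, which preserves model triangles.\<close>

lemma corner_triangle_eq_image:
  assumes "\<bar>det K\<bar> = 1"
  obtains M :: "int ^ 2 ^ 2" where "det M = 1"
    "\<And>l. corner_triangle K p l = (\<lambda>v. map_matrix real_of_int M *v v + p) ` model_triangle l"
proof -
  \<comment> \<open>In both cases this is an adjugate: of \<open>K\<close>, or of \<open>K\<close>
    with its rows exchanged, whose determinant is then \<open>1\<close>.\<close>
  define M :: "int ^ 2 ^ 2" where
    "M = (if det K = 1 then vector [vector [K $ 2 $ 2, - K $ 1 $ 2], vector [- K $ 2 $ 1, K $ 1 $ 1]]
      else vector [vector [K $ 1 $ 2, - K $ 2 $ 2], vector [- K $ 1 $ 1, K $ 2 $ 1]])"
  have detK: "det K = 1 \<or> det K = -1"
    using assms by auto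
  then have "det M = 1"
    by (auto simp: M_def det_2 algebra_simps)
  define \<sigma> :: "real ^ 2 \<Rightarrow> real ^ 2" where
    "\<sigma> v = (if det K = 1 then v else vector [v $ 2, v $ 1])" for v
  have \<sigma>: "\<sigma> v \<in> model_triangle l \<longleftrightarrow> v \<in> model_triangle l" for v l
    by (auto simp: \<sigma>_def model_triangle_def)
  have \<sigma>\<sigma>: "\<sigma> (\<sigma> v) = v" for v
    by (simp add: \<sigma>_def vec2_eq_iff)
  have KM: "corner_coords K p (map_matrix real_of_int M *v v + p) = \<sigma> v" for v
  proof -
    define a b c d where "a = real_of_int (K $ 1 $ 1)" and "b = real_of_int (K $ 1 $ 2)"
      and "c = real_of_int (K $ 2 $ 1)" and "d = real_of_int (K $ 2 $ 2)"
    note abcd = this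
    have det: "real_of_int (det K) = a * d - b * c"
      by (simp add: det_2 abcd)
    have id: "a * (d * x + - b * y) + b * (- c * x + a * y) = (a * d - b * c) * x"
      "c * (d * x + - b * y) + d * (- c * x + a * y) = (a * d - b * c) * y" for x y
      by (simp_all add: algebra_simps)
    have swap: "a * (b * x + - d * y) + b * (- a * x + c * y) = - (a * d - b * c) * y"
      "c * (b * x + - d * y) + d * (- a * x + c * y) = - (a * d - b * c) * x" for x y
      by (simp_all add: algebra_simps)
    show ?thesis
    proof (cases "det K = 1")
      case True
      then show ?thesis
        using det id by (simp add: M_def \<sigma>_def vec2_eq_iff corner_coords_nth matrix_vector_mult_nth2 flip: abcd)
    next
      case False
      then have "a * d - b * c = -1"
        using det detK by simp
      with False show ?thesis
        using swap by (simp add: M_def \<sigma>_def vec2_eq_iff corner_coords_nth matrix_vector_mult_nth2 flip: abcd)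
    qed
  qed
  have "corner_triangle K p l = (\<lambda>v. map_matrix real_of_int M *v v + p) ` model_triangle l" for l
  proof (intro set_eqI iffI)
    fix v assume "v \<in> corner_triangle K p l"
    then have "\<sigma> (corner_coords K p v) \<in> model_triangle l"
      by (simp add: corner_triangle_def \<sigma>)
    moreover have "v = map_matrix real_of_int M *v \<sigma> (corner_coords K p v) + p"
      by (subst corner_coords_eq_iff [OF assms, of p, symmetric]) (simp add: KM \<sigma>\<sigma>)
    ultimately show "v \<in> (\<lambda>v. map_matrix real_of_int M *v v + p) ` model_triangle l"
      by (rule rev_image_eqI)
  next
    fix v assume "v \<in> (\<lambda>v. map_matrix real_of_int M *v v + p) ` model_triangle l"
    then show "v \<in> corner_triangle K p l"
      by (auto simp: corner_triangle_def KM \<sigma>)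
  qed
  with \<open>det M = 1\<close> show ?thesis
    by (rule that)
qed

lemma measure_corner_triangle:
  assumes "\<bar>det K\<bar> = 1" "0 \<le> l"
  shows "corner_triangle K p l \<in> lmeasurable" "measure lebesgue (corner_triangle K p l) = l\<^sup>2 / 2"
proof -
  obtain M :: "int ^ 2 ^ 2" where "det M = 1"
    "\<And>l. corner_triangle K p l = (\<lambda>v. map_matrix real_of_int M *v v + p) ` model_triangle l"
    using corner_triangle_eq_image [OF assms(1)] by metis
  then show "corner_triangle K p l \<in> lmeasurable" "measure lebesgue (corner_triangle K p l) = l\<^sup>2 / 2"
    using measure_moved_model_triangle assms(2) by auto
qed

lemma continuous_on_corner_coords: "continuous_on A (\<lambda>v. corner_coords K p v $ i)"
  unfolding corner_coords_nth by (intro continuous_intros)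

lemma corner_coords_self [simp]: "corner_coords K p p = 0"
  by (simp add: corner_coords_def)

section \<open>Admissibly packed triangles are corner triangles\<close>

text \<open>If \<open>p\<close> were strictly between two points of \<open>S\<close>, a positive
  combination of their nonnegative corner coordinates would vanish; so all these coordinates would
  vanish and both points would equal \<open>p\<close>.\<close>

lemma smooth_corner_extreme_point:
  assumes "smooth_corner S K p"
  shows "p extreme_point_of S"
proof -
  from assms obtain U where U: "\<bar>det K\<bar> = 1"
    "\<And>v. v \<in> S \<Longrightarrow> 0 \<le> corner_coords K p v $ 1 \<and> 0 \<le> corner_coords K p v $ 2"
    "p \<in> U" "\<And>v. v \<in> U \<Longrightarrow> 0 \<le> corner_coords K p v $ 1 \<and> 0 \<le> corner_coords K p v $ 2 \<Longrightarrow> v \<in> S"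
    unfolding smooth_corner_def by metis
  have "p \<in> S"
    using U by simp
  moreover have "p \<notin> open_segment x y" if "x \<in> S" "y \<in> S" for x y
  proof
    assume "p \<in> open_segment x y"
    then obtain u where "x \<noteq> y" and u: "0 < u" "u < 1" "p = (1 - u) *\<^sub>R x + u *\<^sub>R y"
      by (auto simp: in_segment)
    have eq: "(1 - u) * corner_coords K p x $ i + u * corner_coords K p y $ i = corner_coords K p p $ i" for i
      unfolding corner_coords_nth by (subst (5 6) u(3)) (simp add: algebra_simps)
    have "corner_coords K p x $ i = 0 \<and> corner_coords K p y $ i = 0"
      if "0 \<le> corner_coords K p x $ i" "0 \<le> corner_coords K p y $ i" for i
      using eq [of i] u that by (simp add: add_nonneg_eq_0_iff)
    then have "corner_coords K p x = corner_coords K p p" "corner_coords K p y = corner_coords K p p"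
      using U(2) that by (auto simp: vec2_eq_iff)
    then show False
      using \<open>x \<noteq> y\<close> corner_coords_eq_iff [OF U(1)] by metis
  qed
  ultimately show ?thesis
    by (auto simp: extreme_point_of_def)
qed

lemma admissibly_packed_corner_triangle:
  assumes S: "smooth_corner S K p" and "0 < l" "corner_triangle K p l \<subseteq> S"
  shows "admissibly_packed S p (corner_triangle K p l)"
proof -
  from S obtain U where U: "\<bar>det K\<bar> = 1"
    "\<And>v. v \<in> S \<Longrightarrow> 0 \<le> corner_coords K p v $ 1 \<and> 0 \<le> corner_coords K p v $ 2"
    "open U" "p \<in> U"
    unfolding smooth_corner_def by metis
  obtain M :: "int ^ 2 ^ 2" where M: "det M = 1"
    "\<And>l. corner_triangle K p l = (\<lambda>v. map_matrix real_of_int M *v v + p) ` model_triangle l"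
    using corner_triangle_eq_image [OF U(1)] by metis
  \<comment> \<open>\<open>V\<close> is the open half-plane on the corner's side of the hypotenuse.
    Within it, the corner triangle is the full cone, which contains \<open>S\<close>.\<close>
  define V where "V = {v. corner_coords K p v $ 1 + corner_coords K p v $ 2 < l}"
  have "open V"
    unfolding V_def by (intro open_Collect_less continuous_intros continuous_on_corner_coords)
  moreover have "p \<in> V"
    using \<open>0 < l\<close> by (simp add: V_def)
  moreover have "corner_triangle K p l \<inter> V = S \<inter> V"
    using U(2) assms(3) by (fastforce simp: V_def corner_triangle_def model_triangle_def)
  ultimately show ?thesis
    unfolding admissibly_packed_def using smooth_corner_extreme_point [OF S] assms(2,3) M
    by metis
qed

lemma open_ray_point:
  assumes "open U" "p \<in> U"
  obtains e where "0 < e" "p + e *\<^sub>R (w :: real ^ 2) \<in> U"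
proof -
  have "((\<lambda>e. p + e *\<^sub>R w) \<longlongrightarrow> p + 0 *\<^sub>R w) (at_right 0)"
    by (intro tendsto_intros)
  then have "((\<lambda>e. p + e *\<^sub>R w) \<longlongrightarrow> p) (at_right 0)"
    by simp
  then have "\<forall>\<^sub>F e in at_right (0 :: real). p + e *\<^sub>R w \<in> U"
    using assms by (rule topological_tendstoD)
  then have "\<forall>\<^sub>F e in at_right (0 :: real). 0 < e \<and> p + e *\<^sub>R w \<in> U"
    using eventually_conj [OF eventually_at_right_less [of 0]] by blast
  then show ?thesis
    using that eventually_happens' [OF trivial_limit_at_right_real] by blast
qed

text \<open>The nonnegative matrix with rows \<open>A, B\<close> and \<open>C, D\<close> sends
  nonnegative vectors onto positive multiples of both unit vectors. A nonnegative sum vanishes only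
  termwise, so each row has a zero entry; the determinant then leaves only the diagonal or the
  antidiagonal, with unit entries.\<close>

lemma nonneg_unimodular_cone:
  fixes A B C D :: int and y z y' z' :: real
  assumes "\<bar>A * D - B * C\<bar> = 1" "0 \<le> A" "0 \<le> B" "0 \<le> C" "0 \<le> D"
    and "0 \<le> y" "0 \<le> z" "0 \<le> y'" "0 \<le> z'"
    and "0 < A * y + B * z" "C * y + D * z = 0"
    and "A * y' + B * z' = 0" "0 < C * y' + D * z'"
  shows "A = 1 \<and> B = 0 \<and> C = 0 \<and> D = 1 \<or> A = 0 \<and> B = 1 \<and> C = 1 \<and> D = 0"
proof -
  have "y \<noteq> 0 \<or> z \<noteq> 0" "y' \<noteq> 0 \<or> z' \<noteq> 0"
    using assms by auto
  moreover have "C * y = 0" "D * z = 0" "A * y' = 0" "B * z' = 0"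
    using assms by (simp_all add: add_nonneg_eq_0_iff)
  ultimately have "C = 0 \<or> D = 0" "A = 0 \<or> B = 0"
    by auto
  then have "C = 0 \<and> B = 0 \<or> D = 0 \<and> A = 0"
    using assms(1) by auto
  then show ?thesis
  proof
    assume "C = 0 \<and> B = 0"
    with assms(1) have "\<bar>A\<bar> * \<bar>D\<bar> = 1"
      by (simp add: abs_mult)
    then have "\<bar>A\<bar> = 1 \<and> \<bar>D\<bar> = 1"
      by (metis abs_ge_zero zmult_eq_1_iff abs_eq_iff' abs_of_nonneg zero_neq_neg_one abs_abs abs_one)
    then show ?thesis
      using assms \<open>C = 0 \<and> B = 0\<close> by auto
  next
    assume "D = 0 \<and> A = 0"
    with assms(1) have "\<bar>B\<bar> * \<bar>C\<bar> = 1"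
      by (simp add: abs_mult)
    then have "\<bar>B\<bar> = 1 \<and> \<bar>C\<bar> = 1"
      by (metis abs_ge_zero zmult_eq_1_iff abs_eq_iff' abs_of_nonneg zero_neq_neg_one abs_abs abs_one)
    then show ?thesis
      using assms \<open>D = 0 \<and> A = 0\<close> by auto
  qed
qed

lemma corner_coords_add: "corner_coords K p (p + v) = map_matrix real_of_int K *v v"
  by (simp add: corner_coords_def)

lemma map_matrix_real_mult:
  "map_matrix real_of_int K *v (map_matrix real_of_int M *v v) = map_matrix real_of_int (K ** M) *v v"
  for K M :: "int ^ 2 ^ 2"
  by (simp add: matrix_vector_mul_assoc) (simp add: vec_eq_iff matrix_vector_mult_def matrix_matrix_mult_def)

text \<open>Near \<open>p\<close> the packed triangle is a cone spanned by the columns of \<open>M\<close>. In the corner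
  coordinates \<open>K\<close> this cone is the quadrant, so the integer matrix \<open>K M\<close> and its inverse both have
  nonnegative entries: \<open>K M\<close> is a permutation matrix.\<close>

lemma admissibly_packed_imp_corner_triangle:
  assumes "smooth_corner S K p" "admissibly_packed S p B"
  obtains l where "0 < l" "B = corner_triangle K p l"
proof -
  from assms(1) obtain U where U: "\<bar>det K\<bar> = 1"
    "\<And>v. v \<in> S \<Longrightarrow> 0 \<le> corner_coords K p v $ 1 \<and> 0 \<le> corner_coords K p v $ 2"
    "open U" "p \<in> U" "\<And>v. v \<in> U \<Longrightarrow> 0 \<le> corner_coords K p v $ 1 \<and> 0 \<le> corner_coords K p v $ 2 \<Longrightarrow> v \<in> S"
    unfolding smooth_corner_def by metis
  from assms(2) obtain M :: "int ^ 2 ^ 2" and l V where M: "det M = 1" "0 < l"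
    "B = (\<lambda>v. map_matrix real_of_int M *v v + p) ` model_triangle l"
    and V: "open V" "p \<in> V" "B \<inter> V = S \<inter> V" and "B \<subseteq> S"
    unfolding admissibly_packed_def by metis
  define N where "N = K ** M"
  have "\<bar>det N\<bar> = 1"
    using U(1) M(1) by (simp add: N_def det_mul)
  then have detN: "\<bar>N $ 1 $ 1 * N $ 2 $ 2 - N $ 1 $ 2 * N $ 2 $ 1\<bar> = 1"
    by (simp add: det_2)
  have KM: "corner_coords K p (map_matrix real_of_int M *v v + p) = map_matrix real_of_int N *v v" for v
    by (simp add: add.commute [of _ p] corner_coords_add map_matrix_real_mult N_def)
  have N_nonneg: "0 \<le> (map_matrix real_of_int N *v w) $ 1 \<and> 0 \<le> (map_matrix real_of_int N *v w) $ 2"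
    if "w \<in> model_triangle l" for w
    using U(2) [of "map_matrix real_of_int M *v w + p"] that \<open>B \<subseteq> S\<close> M(3) KM by auto
  have "0 \<le> N $ 1 $ 1 \<and> 0 \<le> N $ 2 $ 1"
    using N_nonneg [of "vector [l / 2, 0]"] \<open>0 < l\<close>
    by (simp add: model_triangle_def matrix_vector_mult_nth2 zero_le_mult_iff zero_le_divide_iff)
  moreover have "0 \<le> N $ 1 $ 2 \<and> 0 \<le> N $ 2 $ 2"
    using N_nonneg [of "vector [0, l / 2]"] \<open>0 < l\<close>
    by (simp add: model_triangle_def matrix_vector_mult_nth2 zero_le_mult_iff zero_le_divide_iff)
  \<comment> \<open>A vector \<open>z\<close> of the quadrant may reach beyond the packed triangle,
    so only a small positive multiple of it is lifted; this suffices to compare cones.\<close>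
  moreover have inv: "\<exists>e>0. \<exists>y. 0 \<le> y $ 1 \<and> 0 \<le> y $ 2 \<and> map_matrix real_of_int N *v y = e *\<^sub>R z"
    if z: "0 \<le> z $ 1" "0 \<le> z $ 2" for z
  proof -
    obtain v where v: "corner_coords K p v = z"
      using corner_coords_surj [OF U(1)] by metis
    obtain e where e: "0 < e" "p + e *\<^sub>R (v - p) \<in> U \<inter> V"
      using open_ray_point [of "U \<inter> V" p] U V by blast
    have ez: "corner_coords K p (p + e *\<^sub>R (v - p)) = e *\<^sub>R z"
      using v by (simp add: corner_coords_def matrix_vector_mult_scaleR)
    then have "p + e *\<^sub>R (v - p) \<in> S"
      using U(5) e z by simp
    then have "p + e *\<^sub>R (v - p) \<in> B"
      using V(3) e by blast
    then obtain y where y: "y \<in> model_triangle l" "p + e *\<^sub>R (v - p) = map_matrix real_of_int M *v y + p"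
      using M(3) by blast
    have "map_matrix real_of_int N *v y = e *\<^sub>R z"
      using ez KM [of y] y(2) by metis
    then show ?thesis
      using e(1) y(1) by (auto simp: model_triangle_def)
  qed
  obtain e y where "0 < e" "0 \<le> y $ 1" "0 \<le> y $ 2" "map_matrix real_of_int N *v y = e *\<^sub>R vector [1, 0]"
    using inv [of "vector [1, 0]"] by auto
  moreover obtain e' y' where "0 < e'" "0 \<le> y' $ 1" "0 \<le> y' $ 2" "map_matrix real_of_int N *v y' = e' *\<^sub>R vector [0, 1]"
    using inv [of "vector [0, 1]"] by auto
  ultimately have "N $ 1 $ 1 = 1 \<and> N $ 1 $ 2 = 0 \<and> N $ 2 $ 1 = 0 \<and> N $ 2 $ 2 = 1
      \<or> N $ 1 $ 1 = 0 \<and> N $ 1 $ 2 = 1 \<and> N $ 2 $ 1 = 1 \<and> N $ 2 $ 2 = 0"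
    using detN
    by (intro nonneg_unimodular_cone [of _ _ _ _ "y $ 1" "y $ 2" "y' $ 1" "y' $ 2"])
       (simp_all add: vec2_eq_iff matrix_vector_mult_nth2)
  \<comment> \<open>A 2 by 2 permutation matrix preserves model triangles and is its own inverse;
    the latter provides the preimages needed below.\<close>
  then have N: "map_matrix real_of_int N *v v \<in> model_triangle l \<longleftrightarrow> v \<in> model_triangle l"
    and NN: "map_matrix real_of_int N *v (map_matrix real_of_int N *v v) = v" for v
    by (auto simp: model_triangle_def matrix_vector_mult_nth2 vec2_eq_iff)
  have "B = corner_triangle K p l"
  proof (intro set_eqI iffI)
    fix v assume "v \<in> B"
    then show "v \<in> corner_triangle K p l"
      using M(3) KM N by (auto simp: corner_triangle_def)
  next
    fix v assume v: "v \<in> corner_triangle K p l"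
    define y where "y = map_matrix real_of_int N *v corner_coords K p v"
    have "y \<in> model_triangle l"
      using v N by (simp add: y_def corner_triangle_def)
    moreover have "v = map_matrix real_of_int M *v y + p"
      by (subst corner_coords_eq_iff [OF U(1), of p, symmetric]) (simp add: KM y_def NN)
    ultimately show "v \<in> B"
      unfolding M(3) by (rule rev_image_eqI)
  qed
  with M(2) show ?thesis
    by (rule that)
qed

section \<open>Sizes of the triangles in a packing\<close>

lemma corner_triangle_empty: "l \<le> 0 \<Longrightarrow> corner_triangle K p l = {}"
  by (simp add: corner_triangle_def model_triangle_empty)

lemma corner_triangle_vertex: "0 < l \<Longrightarrow> p \<in> corner_triangle K p l"
  by (simp add: corner_triangle_def model_triangle_def)

text \<open>The hypotenuse is excluded from the triangle, so a point \<open>q\<close> of it can be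
  pushed slightly further away from \<open>p\<close> without leaving it; \<open>q\<close> then lies
  strictly between two points of \<open>S\<close>.\<close>

lemma extreme_point_notin_corner_triangle:
  assumes "q extreme_point_of S" "q \<noteq> p" "corner_triangle K p l \<subseteq> S"
  shows "q \<notin> corner_triangle K p l"
proof
  assume q: "q \<in> corner_triangle K p l"
  define c where "c = corner_coords K p q"
  have c: "0 \<le> c $ 1" "0 \<le> c $ 2" "c $ 1 + c $ 2 < l"
    using q by (auto simp: c_def corner_triangle_def model_triangle_def)
  \<comment> \<open>Chosen so that stretching by \<open>1 + e\<close> uses up at most half of the
    distance \<open>l - (c $ 1 + c $ 2)\<close> left to the hypotenuse.\<close>
  define e where "e = (l - (c $ 1 + c $ 2)) / (2 * l)"
  have e: "0 < e"
    using c by (auto simp: e_def)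
  have "e * (c $ 1 + c $ 2) \<le> e * l"
    using e c by (intro mult_left_mono) auto
  also have "\<dots> = (l - (c $ 1 + c $ 2)) / 2"
    using c by (simp add: e_def)
  finally have "(1 + e) * (c $ 1 + c $ 2) < l"
    using c by (simp add: algebra_simps)
  define v where "v = p + (1 + e) *\<^sub>R (q - p)"
  have "corner_coords K p v = (1 + e) *\<^sub>R c"
    by (simp add: v_def c_def corner_coords_def matrix_vector_mult_scaleR)
  then have "v \<in> corner_triangle K p l"
    using c e \<open>(1 + e) * (c $ 1 + c $ 2) < l\<close>
    by (simp add: corner_triangle_def model_triangle_def distrib_left)
  then have "v \<in> S" "p \<in> S"
    using assms(3) corner_triangle_vertex [of l p K] c by auto
  moreover have "q \<in> open_segment p v"
  proof -
    have "(1 - u) *\<^sub>R p + u *\<^sub>R v = p + (u * (1 + e)) *\<^sub>R (q - p)" for u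
      by (simp add: v_def algebra_simps)
    then have "(1 - 1 / (1 + e)) *\<^sub>R p + (1 / (1 + e)) *\<^sub>R v = q"
      using e by simp
    moreover have "p \<noteq> v"
      using e \<open>q \<noteq> p\<close> by (auto simp: v_def)
    moreover have "0 < 1 / (1 + e)" "1 / (1 + e) < 1"
      using e by auto
    ultimately show ?thesis
      unfolding in_segment by metis
  qed
  ultimately show False
    using assms(1) by (auto simp: extreme_point_of_def)
qed

text \<open>The map \<open>q\<close> parametrises the line of the common side, the side itself lying
  over \<open>[0, t]\<close>. The triangles contain its points over \<open>[0, l)\<close> and
  \<open>(t - l', t]\<close>, and disjoint intervals within \<open>[0, t]\<close> have total length
  at most \<open>t\<close>. The disjunctions leave open which coordinate axis of each corner carries
  the side.\<close>

lemma adjacent_corner_triangles: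
  assumes "smooth_corner S K p" "smooth_corner S K' p'"
    and "corner_triangle K p l \<subseteq> S" "corner_triangle K' p' l' \<subseteq> S"
    and "disjnt (corner_triangle K p l) (corner_triangle K' p' l')" "0 \<le> l" "0 \<le> l'" "0 \<le> t"
    and side: "\<And>r. corner_coords K p (q r) = vector [r, 0] \<or> corner_coords K p (q r) = vector [0, r]"
    and side': "\<And>r. corner_coords K' p' (q r) = vector [t - r, 0] \<or> corner_coords K' p' (q r) = vector [0, t - r]"
  shows "l + l' \<le> t"
proof -
  have qS: "0 \<le> r" "r \<le> t" if "q r \<in> S" for r
  proof -
    have "0 \<le> corner_coords K p (q r) $ 1 \<and> 0 \<le> corner_coords K p (q r) $ 2"
      "0 \<le> corner_coords K' p' (q r) $ 1 \<and> 0 \<le> corner_coords K' p' (q r) $ 2"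
      using assms(1,2) that by (auto simp: smooth_corner_def)
    then show "0 \<le> r" "r \<le> t"
      using side [of r] side' [of r] by auto
  qed
  have q: "q r \<in> corner_triangle K p l" if "0 \<le> r" "r < l" for r
    using side [of r] that by (auto simp: corner_triangle_def model_triangle_def)
  have q': "q r \<in> corner_triangle K' p' l'" if "r \<le> t" "t - r < l'" for r
    using side' [of r] that by (auto simp: corner_triangle_def model_triangle_def)
  have "l \<le> t"
  proof (rule ccontr)
    assume "\<not> l \<le> t"
    then have "q ((l + t) / 2) \<in> S"
      using assms(3,8) q [of "(l + t) / 2"] by auto
    then show False
      using qS(2) \<open>\<not> l \<le> t\<close> by fastforce
  qed
  moreover have "l' \<le> t"
  proof (rule ccontr)
    assume "\<not> l' \<le> t"
    then have "q ((t - l') / 2) \<in> S"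
      using assms(4,8) q' [of "(t - l') / 2"] by (auto simp: field_simps)
    then show False
      using qS(1) \<open>\<not> l' \<le> t\<close> by fastforce
  qed
  moreover have False if "0 < l" "0 < l'" "t < l + l'"
  proof -
    \<comment> \<open>The midpoint of the overlap of the two intervals.\<close>
    define r where "r = (l + t - l') / 2"
    have "0 \<le> r" "r < l" "r \<le> t" "t - r < l'"
      using that \<open>l \<le> t\<close> \<open>l' \<le> t\<close> by (simp_all add: r_def field_simps)
    then have "q r \<in> corner_triangle K p l" "q r \<in> corner_triangle K' p' l'"
      by (auto intro: q q')
    then show False
      using assms(5) by (auto simp: disjnt_def)
  qed
  ultimately show ?thesis
    using assms(6,7) by (cases "l = 0"; cases "l' = 0") force+
qed

lemma measure_Union_corner_triangles:
  assumes "finite I" "\<And>i. i \<in> I \<Longrightarrow> \<bar>det (K i)\<bar> = 1" "\<And>i. i \<in> I \<Longrightarrow> 0 \<le> s i"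
    and "pairwise (\<lambda>i j. disjnt (corner_triangle (K i) (p i) (s i)) (corner_triangle (K j) (p j) (s j))) I"
  shows "measure lebesgue (\<Union>i\<in>I. corner_triangle (K i) (p i) (s i)) = (\<Sum>i\<in>I. (s i)\<^sup>2 / 2)"
proof -
  have "measure lebesgue (\<Union>i\<in>I. corner_triangle (K i) (p i) (s i))
      = (\<Sum>i\<in>I. measure lebesgue (corner_triangle (K i) (p i) (s i)))"
  proof (rule measure_negligible_finite_Union_image)
    show "pairwise (\<lambda>i j. negligible (corner_triangle (K i) (p i) (s i) \<inter> corner_triangle (K j) (p j) (s j))) I"
      using assms(4) by (auto simp: disjnt_def pairwise_def)
  qed (use assms measure_corner_triangle in auto)
  also have "\<dots> = (\<Sum>i\<in>I. (s i)\<^sup>2 / 2)"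
    using assms(2,3) by (intro sum.cong refl measure_corner_triangle)
  finally show ?thesis .
qed

text \<open>Indices of size 0 contribute the empty set and are dropped from the family. Hence
  smoothness is asked only at positive sizes, which accommodates the Delzant triangle with its two
  coinciding vertices.\<close>

lemma toric_packing_corner_triangles:
  assumes "finite I"
    and corner: "\<And>i. i \<in> I \<Longrightarrow> 0 < s i \<Longrightarrow> smooth_corner S (K i) (p i)"
    and subset: "\<And>i. i \<in> I \<Longrightarrow> corner_triangle (K i) (p i) (s i) \<subseteq> S"
    and disj: "pairwise (\<lambda>i j. disjnt (corner_triangle (K i) (p i) (s i)) (corner_triangle (K j) (p j) (s j))) I"
  shows "toric_packing S (\<Union>i\<in>I. corner_triangle (K i) (p i) (s i))"
  unfolding toric_packing_def
proof (intro exI conjI)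
  let ?C = "\<lambda>i. corner_triangle (K i) (p i) (s i)"
  let ?J = "{i \<in> I. 0 < s i}"
  show "finite (?C ` ?J)"
    using assms(1) by simp
  show "\<forall>B\<in>?C ` ?J. \<exists>p. admissibly_packed S p B"
    using admissibly_packed_corner_triangle corner subset by blast
  show "pairwise disjnt (?C ` ?J)"
    using disj by (auto simp: pairwise_def)
  have "?C i = {}" if "\<not> 0 < s i" for i
    using that by (intro corner_triangle_empty) simp
  then show "(\<Union>i\<in>I. ?C i) = \<Union> (?C ` ?J)"
    by blast
qed

text \<open>Every packed triangle contains its vertex, so disjointness allows at most one per
  vertex, and a packing is described by one size for each vertex.\<close>

lemma toric_packing_sizes:
  assumes corner: "\<And>i. i \<in> I \<Longrightarrow> smooth_corner S (K i) (p i)" and "inj_on p I"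
    and ext: "\<And>q. q extreme_point_of S \<Longrightarrow> q \<in> p ` I" and "toric_packing S P"
  obtains s where "\<And>i. i \<in> I \<Longrightarrow> 0 \<le> s i"
    "\<And>i. i \<in> I \<Longrightarrow> corner_triangle (K i) (p i) (s i) \<subseteq> S"
    "pairwise (\<lambda>i j. disjnt (corner_triangle (K i) (p i) (s i)) (corner_triangle (K j) (p j) (s j))) I"
    "P = (\<Union>i\<in>I. corner_triangle (K i) (p i) (s i))"
proof -
  obtain \<B> where \<B>: "\<And>B. B \<in> \<B> \<Longrightarrow> \<exists>p. admissibly_packed S p B"
    "pairwise disjnt \<B>" "P = \<Union>\<B>"
    using assms(4) unfolding toric_packing_def by metis
  have subset: "B \<subseteq> S" if "B \<in> \<B>" for B
    using \<B>(1) [OF that] by (auto simp: admissibly_packed_def)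
  have shape: "\<exists>i\<in>I. \<exists>l>0. B = corner_triangle (K i) (p i) l" if B: "B \<in> \<B>" for B
  proof -
    obtain q where q: "admissibly_packed S q B"
      using \<B>(1) B by blast
    then have "q \<in> p ` I"
      using ext by (simp add: admissibly_packed_def)
    then obtain i where "i \<in> I" "q = p i"
      by blast
    then show ?thesis
      using admissibly_packed_imp_corner_triangle corner q by metis
  qed
  \<comment> \<open>Size 0, meaning the empty triangle, stands for a vertex at which nothing is
    packed.\<close>
  define s where "s i = (if \<exists>l>0. corner_triangle (K i) (p i) l \<in> \<B>
    then SOME l. 0 < l \<and> corner_triangle (K i) (p i) l \<in> \<B> else 0)" for i
  let ?C = "\<lambda>i. corner_triangle (K i) (p i) (s i)"
  have s: "0 < s i \<and> ?C i \<in> \<B> \<or> s i = 0 \<and> (\<forall>l>0. corner_triangle (K i) (p i) l \<notin> \<B>)" for i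
  proof (cases "\<exists>l>0. corner_triangle (K i) (p i) l \<in> \<B>")
    case True
    then have "0 < (SOME l. 0 < l \<and> corner_triangle (K i) (p i) l \<in> \<B>) \<and>
        corner_triangle (K i) (p i) (SOME l. 0 < l \<and> corner_triangle (K i) (p i) l \<in> \<B>) \<in> \<B>"
      by (rule someI_ex)
    with True show ?thesis by (simp add: s_def)
  qed (auto simp: s_def)
  have same: "B = ?C i" if "B \<in> \<B>" "B = corner_triangle (K i) (p i) l" "0 < l" for B i l
  proof -
    have "0 < s i" "?C i \<in> \<B>"
      using s that by blast+
    moreover have "p i \<in> B" "p i \<in> ?C i"
      using that(2,3) \<open>0 < s i\<close> corner_triangle_vertex by blast+
    ultimately show ?thesis
      using \<B>(2) that(1) by (metis disjnt_iff pairwiseD)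
  qed
  show thesis
  proof (rule that)
    show "0 \<le> s i" for i
      using s [of i] by auto
    show sub: "?C i \<subseteq> S" for i
      using s [of i] subset by (auto simp: corner_triangle_empty)
    show "P = (\<Union>i\<in>I. ?C i)"
    proof (intro set_eqI iffI)
      fix v assume "v \<in> P"
      then obtain B where "B \<in> \<B>" "v \<in> B"
        using \<B>(3) by blast
      obtain i l where i: "i \<in> I" "0 < l" "B = corner_triangle (K i) (p i) l"
        using shape [OF \<open>B \<in> \<B>\<close>] by blast
      have "B = ?C i"
        by (rule same [OF \<open>B \<in> \<B>\<close> i(3,2)])
      then show "v \<in> (\<Union>i\<in>I. ?C i)"
        using i(1) \<open>v \<in> B\<close> by (intro UN_I [of i]) simp_all
    next
      fix v assume "v \<in> (\<Union>i\<in>I. ?C i)"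
      then obtain i where "v \<in> ?C i"
        by blast
      then have "?C i \<in> \<B>"
        using s [of i] by (auto simp: corner_triangle_empty)
      then show "v \<in> P"
        using \<open>v \<in> ?C i\<close> \<B>(3) by blast
    qed
    show "pairwise (\<lambda>i j. disjnt (?C i) (?C j)) I"
    proof (rule pairwiseI)
      fix i j assume ij: "i \<in> I" "j \<in> I" "i \<noteq> j"
      consider "s i = 0" | "s j = 0" | "0 < s i" "0 < s j" "?C i \<in> \<B>" "?C j \<in> \<B>"
        using s by metis
      then show "disjnt (?C i) (?C j)"
      proof cases
        \<comment> \<open>Disjointness in the family concerns distinct sets only. The two triangles
          are distinct because the extreme point \<open>p j\<close> lies in the second but not in
          the first.\<close>
        case 3
        have "p j \<noteq> p i"
          using ij assms(2) by (auto dest: inj_onD)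
        then have "p j \<notin> ?C i"
          using smooth_corner_extreme_point corner ij extreme_point_notin_corner_triangle sub by metis
        then have "?C i \<noteq> ?C j"
          using corner_triangle_vertex 3(2) by metis
        then show ?thesis
          using 3 \<B>(2) by (simp add: pairwiseD)
      qed (simp_all add: corner_triangle_empty)
    qed
  qed
qed

section \<open>Density from an optimal packing\<close>

lemma toric_density_eqI:
  assumes "toric_packing S P\<^sub>0" "measure lebesgue P\<^sub>0 = m"
    and "\<And>P. toric_packing S P \<Longrightarrow> measure lebesgue P \<le> m"
  shows "toric_density S = m / measure lebesgue S"
  unfolding toric_density_def
proof (rule cSup_eq_maximum)
  show "m / measure lebesgue S \<in> (\<lambda>P. measure lebesgue P / measure lebesgue S) ` {P. toric_packing S P}"
    using assms(1,2) by auto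
qed (use assms(3) in \<open>auto intro: divide_right_mono\<close>)

lemma toric_packing_measurable_subset:
  assumes "toric_packing S P"
  shows "P \<in> sets lebesgue" "P \<subseteq> S"
proof -
  obtain \<B> where \<B>: "finite \<B>" "\<And>B. B \<in> \<B> \<Longrightarrow> \<exists>p. admissibly_packed S p B" "P = \<Union>\<B>"
    using assms unfolding toric_packing_def by metis
  have "B \<in> sets lebesgue \<and> B \<subseteq> S" if "B \<in> \<B>" for B
    using \<B>(2) [OF that] measure_moved_model_triangle(1)
    unfolding admissibly_packed_def by (metis fmeasurableD less_imp_le)
  then show "P \<in> sets lebesgue" "P \<subseteq> S"
    using \<B>(1,3) by auto
qed

section \<open>Corners and packings of the trapezoid\<close>

definition trapezoid_vertex :: "real \<Rightarrow> real \<Rightarrow> nat \<Rightarrow> nat \<Rightarrow> real ^ 2" where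
  "trapezoid_vertex a b n i =
    (if i = 0 then vector [0, 0] else if i = 1 then vector [0, a] else if i = 2 then vector [b, a]
     else vector [b + real n * a, 0])"

text \<open>The rows are the primitive inward normals of the two sides meeting at vertex
  \<open>i\<close>, so the corner coordinates are the affine distances to these sides.\<close>

definition trapezoid_frame :: "nat \<Rightarrow> nat \<Rightarrow> int ^ 2 ^ 2" where
  "trapezoid_frame n i =
    (if i = 0 then vector [vector [1, 0], vector [0, 1]]
     else if i = 1 then vector [vector [1, 0], vector [0, -1]]
     else if i = 2 then vector [vector [-1, - int n], vector [0, -1]]
     else vector [vector [-1, - int n], vector [0, 1]])"

lemma corner_coords_trapezoid:
  "corner_coords (trapezoid_frame n i) (trapezoid_vertex a b n i) v =
    (if i = 0 then vector [v $ 1, v $ 2] else if i = 1 then vector [v $ 1, a - v $ 2]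
     else if i = 2 then vector [b + real n * a - v $ 1 - real n * v $ 2, a - v $ 2]
     else vector [b + real n * a - v $ 1 - real n * v $ 2, v $ 2])"
  by (simp add: vec2_eq_iff corner_coords_nth trapezoid_frame_def trapezoid_vertex_def algebra_simps)

lemma smooth_corner_trapezoid:
  assumes "0 < a" "0 \<le> b" "0 < b + real n * a" "i = 1 \<or> i = 2 \<Longrightarrow> 0 < b"
  shows "smooth_corner (hirzebruch_trapezoid a b n) (trapezoid_frame n i) (trapezoid_vertex a b n i)"
proof -
  let ?T = "hirzebruch_trapezoid a b n"
  note T = hirzebruch_trapezoid_eq [OF assms(1,2)]
  \<comment> \<open>\<open>U\<close> makes strict the two inequalities that are not active at vertex
    \<open>i\<close>; inside it the two corner coordinates decide membership. For vertices 1 and 2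
    this needs \<open>0 < b\<close>, since they coincide when \<open>b = 0\<close>.\<close>
  define U where "U = (if i = 0 then {v :: real ^ 2. v $ 2 < a \<and> v $ 1 + real n * v $ 2 < b + real n * a}
    else if i = 1 then {v. 0 < v $ 2 \<and> v $ 1 + real n * v $ 2 < b + real n * a}
    else if i = 2 then {v. 0 < v $ 1 \<and> 0 < v $ 2}
    else {v. 0 < v $ 1 \<and> v $ 2 < a})"
  have "open U"
    by (auto simp: U_def intro!: open_Collect_conj open_Collect_less continuous_intros)
  moreover have "trapezoid_vertex a b n i \<in> U"
    using assms by (auto simp: U_def trapezoid_vertex_def)
  moreover have "\<bar>det (trapezoid_frame n i)\<bar> = 1"
    by (simp add: trapezoid_frame_def det_2)
  ultimately show ?thesis
    unfolding smooth_corner_def corner_coords_trapezoid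
    by (intro conjI exI [of _ U]) (auto simp: T U_def)
qed

lemma extreme_point_of_trapezoid:
  assumes "q extreme_point_of hirzebruch_trapezoid a b n"
  shows "q \<in> trapezoid_vertex a b n ` {..<4}"
proof -
  have "{..<4} = {0, 1, 2, 3 :: nat}"
    by auto
  then show ?thesis
    using extreme_point_of_convex_hull [OF assms[unfolded hirzebruch_trapezoid_def]]
    by (auto simp: trapezoid_vertex_def)
qed

lemma sum_lessThan_4: "(\<Sum>i<4. f i) = f 0 + f 1 + f 2 + f 3" for f :: "nat \<Rightarrow> 'a::comm_monoid_add"
  by (simp add: numeral_eq_Suc)

lemma trapezoid_packing_sizes:
  assumes "0 < a" "0 < b" and P: "toric_packing (hirzebruch_trapezoid a b n) P"
  obtains w x y z where "0 \<le> w" "0 \<le> x" "0 \<le> y" "0 \<le> z"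
    "w + x \<le> a" "x + y \<le> b" "y + z \<le> a" "w + z \<le> b + real n * a"
    "measure lebesgue P = (w\<^sup>2 + x\<^sup>2 + y\<^sup>2 + z\<^sup>2) / 2"
proof -
  let ?T = "hirzebruch_trapezoid a b n"
  let ?K = "trapezoid_frame n" and ?p = "trapezoid_vertex a b n"
  have corner: "smooth_corner ?T (?K i) (?p i)" for i
    using assms by (intro smooth_corner_trapezoid) (auto intro: add_pos_nonneg)
  have "inj_on ?p {..<4}"
    using assms(1,2) add_pos_nonneg [of b "real n * a"]
    by (auto simp: inj_on_def trapezoid_vertex_def vec2_eq_iff less_Suc_eq numeral_eq_Suc)
  then obtain s where s: "\<And>i. i < 4 \<Longrightarrow> 0 \<le> s i"
    "\<And>i. i < 4 \<Longrightarrow> corner_triangle (?K i) (?p i) (s i) \<subseteq> ?T"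
    "pairwise (\<lambda>i j. disjnt (corner_triangle (?K i) (?p i) (s i)) (corner_triangle (?K j) (?p j) (s j))) {..<4}"
    "P = (\<Union>i<4. corner_triangle (?K i) (?p i) (s i))"
    using toric_packing_sizes [of "{..<4}" ?T ?K ?p P] corner extreme_point_of_trapezoid P by auto
  have "measure lebesgue P = (\<Sum>i<4. (s i)\<^sup>2 / 2)"
    unfolding s(4) using s corner
    by (intro measure_Union_corner_triangles) (auto simp: smooth_corner_def)
  then have "measure lebesgue P = ((s 0)\<^sup>2 + (s 1)\<^sup>2 + (s 2)\<^sup>2 + (s 3)\<^sup>2) / 2"
    by (simp add: sum_lessThan_4)
  moreover have disj: "disjnt (corner_triangle (?K i) (?p i) (s i)) (corner_triangle (?K j) (?p j) (s j))"
    if "i < 4" "j < 4" "i \<noteq> j" for i j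
    using s(3) that by (simp add: pairwise_def)
  have side: "s i + s j \<le> t"
    if "i < 4" "j < 4" "i \<noteq> j" "0 \<le> t"
      "\<And>r. corner_coords (?K i) (?p i) (q r) = vector [r, 0] \<or> corner_coords (?K i) (?p i) (q r) = vector [0, r]"
      "\<And>r. corner_coords (?K j) (?p j) (q r) = vector [t - r, 0] \<or> corner_coords (?K j) (?p j) (q r) = vector [0, t - r]"
    for i j t q
    using adjacent_corner_triangles [OF corner corner s(2) s(2) disj s(1) s(1)] that by blast
  \<comment> \<open>Each \<open>q\<close> below follows one side with its primitive direction as
    velocity, so \<open>t\<close> is the affine length of that side.\<close>
  have "s 0 + s 1 \<le> a"
    using assms by (intro side [where q = "\<lambda>r. vector [0, r]"]) (auto simp: corner_coords_trapezoid)
  moreover have "s 1 + s 2 \<le> b"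
    using assms by (intro side [where q = "\<lambda>r. vector [r, a]"]) (auto simp: corner_coords_trapezoid)
  moreover have "s 2 + s 3 \<le> a"
    using assms by (intro side [where q = "\<lambda>r. vector [b + real n * r, a - r]"])
      (auto simp: corner_coords_trapezoid algebra_simps)
  moreover have "s 0 + s 3 \<le> b + real n * a"
    using assms by (intro side [where q = "\<lambda>r. vector [r, 0]"])
      (auto simp: corner_coords_trapezoid algebra_simps)
  ultimately show ?thesis
    using s(1) by (intro that [of "s 0" "s 1" "s 2" "s 3"]) auto
qed

lemma trapezoid_packing_exists:
  assumes "0 < a" "0 \<le> b" "0 \<le> w" "0 \<le> y" "0 \<le> z"
    and le: "w \<le> a" "y \<le> b" "y + z \<le> a" "w + z \<le> b + real n * a"
  obtains P where "toric_packing (hirzebruch_trapezoid a b n) P"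
    "measure lebesgue P = (w\<^sup>2 + y\<^sup>2 + z\<^sup>2) / 2"
proof -
  let ?T = "hirzebruch_trapezoid a b n"
  note T = hirzebruch_trapezoid_eq [OF assms(1,2), of n]
  let ?K = "trapezoid_frame n" and ?p = "trapezoid_vertex a b n"
  define s where "s i = (if i = 0 then w else if i = 1 then 0 else if i = 2 then y else z)" for i :: nat
  let ?C = "\<lambda>i. corner_triangle (?K i) (?p i) (s i)"
  have C0: "v \<in> ?C 0 \<longleftrightarrow> 0 \<le> v $ 1 \<and> 0 \<le> v $ 2 \<and> v $ 1 + v $ 2 < w" for v
    by (simp add: corner_triangle_def model_triangle_def corner_coords_trapezoid s_def)
  have C1: "?C 1 = {}"
    by (simp add: corner_triangle_empty s_def)
  have C2: "v \<in> ?C 2 \<longleftrightarrow> 0 \<le> b + real n * (a - v $ 2) - v $ 1 \<and> v $ 2 \<le> a \<and>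
      b + real n * (a - v $ 2) - v $ 1 + (a - v $ 2) < y" for v
    by (auto simp: corner_triangle_def model_triangle_def corner_coords_trapezoid s_def algebra_simps)
  have C3: "v \<in> ?C 3 \<longleftrightarrow> 0 \<le> b + real n * (a - v $ 2) - v $ 1 \<and> 0 \<le> v $ 2 \<and>
      b + real n * (a - v $ 2) - v $ 1 + v $ 2 < z" for v
    by (auto simp: corner_triangle_def model_triangle_def corner_coords_trapezoid s_def algebra_simps)
  have T': "v \<in> ?T \<longleftrightarrow> 0 \<le> v $ 1 \<and> 0 \<le> v $ 2 \<and> v $ 2 \<le> a \<and> 0 \<le> b + real n * (a - v $ 2) - v $ 1" for v
    by (auto simp: T algebra_simps)
  have n_pos: "c \<le> real n * c" if "n \<noteq> 0" "0 \<le> c" for c :: real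
    using that by (cases n) (auto simp: distrib_right)
  have "?C 0 \<subseteq> ?T"
  proof
    fix v assume v: "v \<in> ?C 0"
    show "v \<in> ?T"
    \<comment> \<open>For positive \<open>n\<close> the slanted side leaves enough room for any
      \<open>w \<le> a\<close>; in the rectangle it is \<open>w + z \<le> b\<close> that keeps the
      triangle inside.\<close>
    proof (cases "n = 0")
      case False
      then have "a - v $ 2 \<le> real n * (a - v $ 2)"
        using v le by (intro n_pos) (auto simp: C0)
      then show ?thesis
        using v le assms(2) unfolding C0 T' by linarith
    next
      case True
      with v le assms(5) show ?thesis
        unfolding C0 T' by simp
    qed
  qed
  moreover have "?C 2 \<subseteq> ?T"
  proof
    fix v assume v: "v \<in> ?C 2"
    then have "0 \<le> real n * (a - v $ 2)"
      by (intro mult_nonneg_nonneg) (auto simp: C2)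
    then show "v \<in> ?T"
      using v le assms(5) unfolding C2 T' by linarith
  qed
  moreover have "?C 3 \<subseteq> ?T"
  proof
    fix v assume v: "v \<in> ?C 3"
    then have "v $ 2 \<le> a"
      using le assms(4) unfolding C3 by linarith
    show "v \<in> ?T"
    proof (cases "n = 0")
      case False
      then have "a - v $ 2 \<le> real n * (a - v $ 2)"
        using \<open>v $ 2 \<le> a\<close> by (intro n_pos) auto
      then show ?thesis
        using v le assms(2,4) unfolding C3 T' by linarith
    next
      case True
      with v le assms(3) \<open>v $ 2 \<le> a\<close> show ?thesis
        unfolding C3 T' by simp
    qed
  qed
  ultimately have subset: "?C i \<subseteq> ?T" if "i < 4" for i
    using that C1 by (auto simp: less_Suc_eq numeral_eq_Suc)
  \<comment> \<open>These triangles sit at opposite vertices: the sum of the coordinates is below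
    \<open>w \<le> a\<close> on the first and above \<open>a + b - y \<ge> a\<close> on the
    second.\<close>
  have "disjnt (?C 0) (?C 2)"
  proof -
    have False if "v \<in> ?C 0" "v \<in> ?C 2" for v
    proof -
      have "0 \<le> real n * (a - v $ 2)"
        using that by (intro mult_nonneg_nonneg) (auto simp: C2)
      then show False
        using that le unfolding C0 C2 by linarith
    qed
    then show ?thesis by (auto simp: disjnt_def)
  qed
  moreover have "disjnt (?C 0) (?C 3)"
  proof -
    have False if v: "v \<in> ?C 0" "v \<in> ?C 3" for v
    \<comment> \<open>For \<open>n \<le> 1\<close> the bound on the bottom side separates the
      triangles. For larger \<open>n\<close> the bottom side is longer than \<open>2 * a\<close> or
      equal to it, and sizes at most \<open>a\<close> are enough.\<close>
    proof (cases "n \<le> 1")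
      case True
      then have "n = 0 \<or> n = 1" by auto
      then show False
        using v le by (auto simp: C0 C3)
    next
      case False
      have "2 * (a - v $ 2) \<le> real n * (a - v $ 2)"
        using v le False by (intro mult_right_mono) (auto simp: C0)
      moreover define m where "m = real n * (a - v $ 2)"
      ultimately have "2 * (a - v $ 2) \<le> m" "v $ 1 + v $ 2 < w" "b + m - v $ 1 + v $ 2 < z"
        using v by (auto simp: C0 C3)
      then show False
        using le(1,3) assms(2,4) by argo
    qed
    then show ?thesis by (auto simp: disjnt_def)
  qed
  moreover have "disjnt (?C 2) (?C 3)"
  proof -
    have False if "v \<in> ?C 2" "v \<in> ?C 3" for v
      using that le unfolding C2 C3 by linarith
    then show ?thesis by (auto simp: disjnt_def)
  qed
  ultimately have disj: "pairwise (\<lambda>i j. disjnt (?C i) (?C j)) {..<4}"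
    using C1 by (auto simp: pairwise_def less_Suc_eq numeral_eq_Suc disjnt_sym)
  have s0: "0 \<le> s i" for i
    using assms by (simp add: s_def)
  have "toric_packing ?T (\<Union>i<4. ?C i)"
  proof (rule toric_packing_corner_triangles)
    fix i :: nat assume "i \<in> {..<4}" "0 < s i"
    moreover have "0 < b + real n * a" if "0 < b"
      using that assms(1) by (simp add: add_pos_nonneg)
    ultimately show "smooth_corner ?T (?K i) (?p i)"
      using assms by (intro smooth_corner_trapezoid) (auto simp: s_def split: if_splits)
  qed (use subset disj in auto)
  moreover have "measure lebesgue (\<Union>i<4. ?C i) = (\<Sum>i<4. (s i)\<^sup>2 / 2)"
    using disj s0 by (intro measure_Union_corner_triangles) (auto simp: trapezoid_frame_def det_2)
  then have "measure lebesgue (\<Union>i<4. ?C i) = (w\<^sup>2 + y\<^sup>2 + z\<^sup>2) / 2"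
    by (simp add: sum_lessThan_4 s_def)
  ultimately show ?thesis
    by (rule that)
qed

section \<open>Maximising the sum of the squared sizes\<close>

text \<open>Convexity: at a fixed sum, two squares add up to more the further their bases are apart.
  If \<open>u\<close> lies between \<open>q\<close> and \<open>p\<close>, raising \<open>v\<close>
  to \<open>p + q - u\<close> leaves the gap \<open>2 * ((p - u) * (u - q))\<close>; otherwise the
  squares compare termwise.\<close>

lemma sum_squares_le_majorizing:
  fixes u v p q :: real
  assumes "0 \<le> u" "0 \<le> v" "0 \<le> q" "u \<le> p" "v \<le> p" "u + v \<le> p + q"
  shows "u\<^sup>2 + v\<^sup>2 \<le> p\<^sup>2 + q\<^sup>2"
proof (cases "u \<le> q")
  case True
  then have "u\<^sup>2 \<le> q\<^sup>2" "v\<^sup>2 \<le> p\<^sup>2"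
    using assms by (auto intro: power_mono)
  then show ?thesis by simp
next
  case False
  then have "0 \<le> (p - u) * (u - q)"
    using assms by simp
  moreover have "v\<^sup>2 \<le> (p + q - u)\<^sup>2"
    using assms by (intro power_mono) auto
  moreover have "(p + q - u)\<^sup>2 = p\<^sup>2 + q\<^sup>2 - u\<^sup>2 - 2 * ((p - u) * (u - q))"
    by (simp add: power2_eq_square algebra_simps)
  ultimately show ?thesis by linarith
qed

lemma sum_squares_le_square:
  fixes u v p :: real
  assumes "0 \<le> u" "0 \<le> v" "u + v \<le> p"
  shows "u\<^sup>2 + v\<^sup>2 \<le> p\<^sup>2"
  using sum_squares_le_majorizing [of u v 0 p] assms by simp

lemma sizes_bound_middle:
  fixes a b w x y z :: real
  assumes "0 \<le> w" "0 \<le> x" "0 \<le> y" "0 \<le> z"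
    and "w + x \<le> a" "x + y \<le> b" "y + z \<le> a" "w + z \<le> b + a" "b < a" "a < 2 * b"
  shows "w\<^sup>2 + x\<^sup>2 + y\<^sup>2 + z\<^sup>2 \<le> a\<^sup>2 + b\<^sup>2 + (a - b)\<^sup>2"
proof (cases "w + z \<le> a")
  case True
  then have "w\<^sup>2 + z\<^sup>2 \<le> a\<^sup>2" "x\<^sup>2 + y\<^sup>2 \<le> b\<^sup>2"
    using assms by (auto intro: sum_squares_le_square)
  moreover have "0 \<le> (a - b)\<^sup>2"
    by simp
  ultimately show ?thesis by linarith
next
  case False
  \<comment> \<open>The excess of \<open>w + z\<close> over \<open>a\<close>. Spreading
    \<open>w\<close> and \<open>z\<close> apart replaces them by \<open>a\<close> and
    \<open>q\<close>.\<close>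
  define q where "q = w + z - a"
  have wz: "w\<^sup>2 + z\<^sup>2 \<le> a\<^sup>2 + q\<^sup>2"
    using assms False by (intro sum_squares_le_majorizing) (auto simp: q_def)
  show ?thesis
  \<comment> \<open>The sum \<open>x + y\<close> is bounded by \<open>b\<close> and, through the
    left and slanted sides, by \<open>a - q\<close>; the two bounds agree at
    \<open>q = a - b\<close>.\<close>
  proof (cases "q \<le> a - b")
    case True
    then have "q\<^sup>2 \<le> (a - b)\<^sup>2"
      using False by (intro power_mono) (auto simp: q_def)
    moreover have "x\<^sup>2 + y\<^sup>2 \<le> b\<^sup>2"
      using assms by (intro sum_squares_le_square)
    ultimately show ?thesis using wz by linarith
  next
    case q: False
    have "x\<^sup>2 + y\<^sup>2 \<le> (a - q)\<^sup>2"
      using assms by (intro sum_squares_le_square) (auto simp: q_def)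
    moreover have "q\<^sup>2 + (a - q)\<^sup>2 \<le> b\<^sup>2 + (a - b)\<^sup>2"
      using assms q False by (intro sum_squares_le_majorizing) (auto simp: q_def)
    ultimately show ?thesis using wz by linarith
  qed
qed

section \<open>The densities case by case\<close>

text \<open>Turns the density into a quadratic optimisation over four sizes, with a proposed
  maximiser of size 0 at \<open>(0, a)\<close>. The factors 1/2 in the areas of triangles and
  trapezoid cancel.\<close>

lemma toric_density_trapezoid_eqI:
  assumes "0 < a" "0 < b" "0 \<le> w" "0 \<le> y" "0 \<le> z"
    and "w \<le> a" "y \<le> b" "y + z \<le> a" "w + z \<le> b + real n * a"
    and upper: "\<And>w' x' y' z'. \<lbrakk>0 \<le> w'; 0 \<le> x'; 0 \<le> y'; 0 \<le> z'; w' + x' \<le> a; x' + y' \<le> b;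
      y' + z' \<le> a; w' + z' \<le> b + real n * a\<rbrakk> \<Longrightarrow>
      w'\<^sup>2 + x'\<^sup>2 + y'\<^sup>2 + z'\<^sup>2 \<le> w\<^sup>2 + y\<^sup>2 + z\<^sup>2"
  shows "toric_density (hirzebruch_trapezoid a b n) =
    (w\<^sup>2 + y\<^sup>2 + z\<^sup>2) / ((real n * a + 2 * b) * a)"
proof -
  obtain P\<^sub>0 where P\<^sub>0: "toric_packing (hirzebruch_trapezoid a b n) P\<^sub>0"
    "measure lebesgue P\<^sub>0 = (w\<^sup>2 + y\<^sup>2 + z\<^sup>2) / 2"
    using trapezoid_packing_exists [of a b w y z n] assms by auto
  have "measure lebesgue P \<le> (w\<^sup>2 + y\<^sup>2 + z\<^sup>2) / 2"
    if "toric_packing (hirzebruch_trapezoid a b n) P" for P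
    using trapezoid_packing_sizes [OF assms(1,2) that] upper
    by (metis divide_right_mono zero_le_numeral)
  from toric_density_eqI [OF P\<^sub>0 this]
  have "toric_density (hirzebruch_trapezoid a b n) =
      (w\<^sup>2 + y\<^sup>2 + z\<^sup>2) / 2 / (a * (2 * b + real n * a) / 2)"
    using assms(1,2) by (simp add: measure_trapezoid)
  also have "a * (2 * b + real n * a) = (real n * a + 2 * b) * a"
    by (simp add: algebra_simps)
  finally have "toric_density (hirzebruch_trapezoid a b n) =
      (w\<^sup>2 + y\<^sup>2 + z\<^sup>2) / 2 / ((real n * a + 2 * b) * a / 2)" .
  moreover have "c / 2 / (d / 2) = c / d" for c d :: real
    by simp
  ultimately show ?thesis
    by (simp only:)
qed

lemma toric_density_delzant_triangle:
  assumes "0 < a"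
  shows "toric_density (delzant_triangle a) = 1"
proof -
  let ?T = "hirzebruch_trapezoid a 0 1"
  obtain P\<^sub>0 where P\<^sub>0: "toric_packing ?T P\<^sub>0" "measure lebesgue P\<^sub>0 = a\<^sup>2 / 2"
    using trapezoid_packing_exists [of a 0 a 0 0 1] assms by auto
  have area: "measure lebesgue ?T = a\<^sup>2 / 2"
    using assms by (simp add: measure_trapezoid power2_eq_square)
  have "measure lebesgue P \<le> a\<^sup>2 / 2" if "toric_packing ?T P" for P
    using measure_mono_fmeasurable [OF toric_packing_measurable_subset(2,1) [OF that] lmeasurable_trapezoid]
    unfolding area .
  from toric_density_eqI [OF P\<^sub>0 this] have "toric_density ?T = a\<^sup>2 / 2 / (a\<^sup>2 / 2)"
    unfolding area .
  then show ?thesis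
    using assms by (simp add: delzant_triangle_eq_trapezoid)
qed

text \<open>The left and the slanted side each bound a pair of squares by the square of
  \<open>a\<close>. Equality holds with size \<open>a\<close> at the origin and again at one end of
  the slanted side: the upper end for \<open>y = a\<close>, the lower one for
  \<open>y = 0\<close>.\<close>

lemma toric_density_trapezoid_two_squares:
  assumes "0 < a" "0 < b" "0 \<le> y" "y \<le> a" "y \<le> b" "2 * a - y \<le> b + real n * a" "y = 0 \<or> y = a"
  shows "toric_density (hirzebruch_trapezoid a b n) = 2 * a / (real n * a + 2 * b)"
proof -
  have "toric_density (hirzebruch_trapezoid a b n) =
      (a\<^sup>2 + y\<^sup>2 + (a - y)\<^sup>2) / ((real n * a + 2 * b) * a)"
  proof (rule toric_density_trapezoid_eqI)
    fix w' x' y' z' :: real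
    assume "0 \<le> w'" "0 \<le> x'" "0 \<le> y'" "0 \<le> z'" "w' + x' \<le> a" "y' + z' \<le> a"
    then have "w'\<^sup>2 + x'\<^sup>2 \<le> a\<^sup>2" "y'\<^sup>2 + z'\<^sup>2 \<le> a\<^sup>2"
      by (simp_all add: sum_squares_le_square)
    then show "w'\<^sup>2 + x'\<^sup>2 + y'\<^sup>2 + z'\<^sup>2 \<le> a\<^sup>2 + y\<^sup>2 + (a - y)\<^sup>2"
      using assms(7) by auto
  qed (use assms in auto)
  also have "a\<^sup>2 + y\<^sup>2 + (a - y)\<^sup>2 = 2 * a * a"
    using assms(7) by (auto simp: power2_eq_square)
  finally show ?thesis
    using assms(1) by simp
qed

lemma toric_density_rectangle:
  assumes "0 < a" "0 < b"
  shows "toric_density (rectangle a b) = min a b / max a b"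
proof (cases "a \<le> b")
  case True
  then have "toric_density (rectangle a b) = 2 * a / (real 0 * a + 2 * b)"
    unfolding rectangle_eq_trapezoid using assms
    by (intro toric_density_trapezoid_two_squares [of _ _ a]) auto
  with True show ?thesis by simp
next
  case False
  \<comment> \<open>Now the shorter sides are the horizontal ones; they bound the pairs, and
    triangles of size \<open>b\<close> at \<open>(0, 0)\<close> and \<open>(b, a)\<close> are
    optimal.\<close>
  have "toric_density (rectangle a b) = (b\<^sup>2 + b\<^sup>2 + 0\<^sup>2) / ((real 0 * a + 2 * b) * a)"
    unfolding rectangle_eq_trapezoid
  proof (rule toric_density_trapezoid_eqI)
    fix w x y z :: real
    assume "0 \<le> w" "0 \<le> x" "0 \<le> y" "0 \<le> z" "x + y \<le> b" "w + z \<le> b + real 0 * a"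
    then have "x\<^sup>2 + y\<^sup>2 \<le> b\<^sup>2" "w\<^sup>2 + z\<^sup>2 \<le> b\<^sup>2"
      by (simp_all add: sum_squares_le_square)
    then show "w\<^sup>2 + x\<^sup>2 + y\<^sup>2 + z\<^sup>2 \<le> b\<^sup>2 + b\<^sup>2 + 0\<^sup>2"
      by simp
  qed (use assms False in auto)
  with False assms show ?thesis
    by (simp add: power2_eq_square)
qed

text \<open>With \<open>w = a\<close>, the choices \<open>z = b\<close> and \<open>y = a - b\<close>
  exhaust the bottom and the slanted side; \<open>a < 2 * b\<close> ensures
  \<open>y \<le> b\<close>.\<close>

lemma toric_density_trapezoid_middle:
  assumes "0 < b" "b < a" "a < 2 * b"
  shows "toric_density (hirzebruch_trapezoid a b 1) =
    (a\<^sup>2 + b\<^sup>2 + (a - b)\<^sup>2) / ((a + 2 * b) * a)"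
proof -
  have "toric_density (hirzebruch_trapezoid a b 1) =
      (a\<^sup>2 + (a - b)\<^sup>2 + b\<^sup>2) / ((real 1 * a + 2 * b) * a)"
  proof (rule toric_density_trapezoid_eqI)
    fix w x y z :: real
    assume "0 \<le> w" "0 \<le> x" "0 \<le> y" "0 \<le> z"
      "w + x \<le> a" "x + y \<le> b" "y + z \<le> a" "w + z \<le> b + real 1 * a"
    then show "w\<^sup>2 + x\<^sup>2 + y\<^sup>2 + z\<^sup>2 \<le> a\<^sup>2 + (a - b)\<^sup>2 + b\<^sup>2"
      using sizes_bound_middle [of w x y z a b] assms by simp
  qed (use assms in auto)
  then show ?thesis by (simp add: add_ac)
qed

text \<open>The bottom pair and the top pair are maximised separately, by
  \<open>w = a, z = b\<close> and by \<open>x = 0, y = b\<close>. The slanted side admits both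
  choices at once because \<open>2 * b \<le> a\<close>.\<close>

lemma toric_density_trapezoid_steep:
  assumes "0 < b" "2 * b \<le> a"
  shows "toric_density (hirzebruch_trapezoid a b 1) = (a\<^sup>2 + 2 * b\<^sup>2) / ((a + 2 * b) * a)"
proof -
  have "toric_density (hirzebruch_trapezoid a b 1) =
      (a\<^sup>2 + b\<^sup>2 + b\<^sup>2) / ((real 1 * a + 2 * b) * a)"
  proof (rule toric_density_trapezoid_eqI)
    fix w x y z :: real
    assume *: "0 \<le> w" "0 \<le> x" "0 \<le> y" "0 \<le> z"
      "w + x \<le> a" "x + y \<le> b" "y + z \<le> a" "w + z \<le> b + real 1 * a"
    have "w\<^sup>2 + z\<^sup>2 \<le> a\<^sup>2 + b\<^sup>2"
      using * assms by (intro sum_squares_le_majorizing) auto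
    moreover have "x\<^sup>2 + y\<^sup>2 \<le> b\<^sup>2"
      using * by (intro sum_squares_le_square)
    ultimately show "w\<^sup>2 + x\<^sup>2 + y\<^sup>2 + z\<^sup>2 \<le> a\<^sup>2 + b\<^sup>2 + b\<^sup>2"
      by linarith
  qed (use assms in auto)
  then show ?thesis by simp
qed

theorem theorem1p5:
  fixes a b :: real
  assumes "a > 0" and "b > 0"
  shows "(delzant_polygon (delzant_triangle a) \<and> toric_density (delzant_triangle a) = 1) \<and>
    (delzant_polygon (rectangle a b) \<and> toric_density (rectangle a b) = min a b / max a b) \<and>
    (\<forall>n::nat. n > 0 \<longrightarrow>
      delzant_polygon (hirzebruch_trapezoid a b n) \<and>
      (n > 1 \<longrightarrow> toric_density (hirzebruch_trapezoid a b n) = 2 * a / (real n * a + 2 * b)) \<and>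
      (n = 1 \<and> a \<le> b \<longrightarrow>
         toric_density (hirzebruch_trapezoid a b n) = 2 * a / (a + 2 * b)) \<and>
      (n = 1 \<and> b < a \<and> a < 2 * b \<longrightarrow>
         toric_density (hirzebruch_trapezoid a b n) =
           (a\<^sup>2 + b\<^sup>2 + (a - b)\<^sup>2) / ((a + 2 * b) * a)) \<and>
      (n = 1 \<and> a \<ge> 2 * b \<longrightarrow>
         toric_density (hirzebruch_trapezoid a b n) = (a\<^sup>2 + 2 * b\<^sup>2) / ((a + 2 * b) * a)))"
proof (intro conjI allI impI)
  fix n :: nat
  assume "0 < n"
  show "delzant_polygon (hirzebruch_trapezoid a b n)"
    using assms by (intro delzant_polygon_trapezoid) auto
  show "toric_density (hirzebruch_trapezoid a b n) = 2 * a / (real n * a + 2 * b)" if "1 < n"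
  proof (rule toric_density_trapezoid_two_squares [of _ _ 0])
    \<comment> \<open>For \<open>n > 1\<close> the bottom side has room for triangles of size
      \<open>a\<close> at both of its ends.\<close>
    have "2 * a \<le> real n * a"
      using that assms by (intro mult_right_mono) auto
    then show "2 * a - 0 \<le> b + real n * a"
      using assms by linarith
  qed (use assms in auto)
  show "toric_density (hirzebruch_trapezoid a b n) = 2 * a / (a + 2 * b)" if "n = 1 \<and> a \<le> b"
    using toric_density_trapezoid_two_squares [of a b 0 1] that assms by simp
  show "toric_density (hirzebruch_trapezoid a b n) =
      (a\<^sup>2 + b\<^sup>2 + (a - b)\<^sup>2) / ((a + 2 * b) * a)" if "n = 1 \<and> b < a \<and> a < 2 * b"
    using toric_density_trapezoid_middle that assms by blast
  show "toric_density (hirzebruch_trapezoid a b n) = (a\<^sup>2 + 2 * b\<^sup>2) / ((a + 2 * b) * a)"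
    if "n = 1 \<and> 2 * b \<le> a"
    using toric_density_trapezoid_steep that assms by blast
next
  show "delzant_polygon (delzant_triangle a)"
    unfolding delzant_triangle_eq_trapezoid using assms by (intro delzant_polygon_trapezoid) auto
  show "delzant_polygon (rectangle a b)"
    unfolding rectangle_eq_trapezoid using assms by (intro delzant_polygon_trapezoid) auto
qed (use assms in \<open>simp_all add: toric_density_delzant_triangle toric_density_rectangle\<close>)

end
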